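(* Let $\mathcal{H}$ be an infinite-dimensional separable complex Hilbert space and let $T$ be a bounded linear operator on $\mathcal{H}$ that is not a scalar multiple of the identity. Suppose that there exist an orthonormal basis $\{e_n\}_{n\in\mathbb{N}}$ of $\mathcal{H}$ and some $n_0\in\mathbb{N}$ such that $$\langle T e_n,e_{n+\ell}\rangle=\langle T^{*}e_n,e_{n+\ell}\rangle=0$$ for every $\ell\geq 2$ and every $n\geq n_0$. If $[T^*,T]=T^*T-TT^*$ is a trace-class operator with non-zero trace, then $T$ has a nontrivial closed hyperinvariant subspace.
   Context: A closed subspace $M$ is hyperinvariant for $T$ if it is invariant under every bounded operator commuting with $T$; it is nontrivial if $M\neq\{0\}$ and $M\neq\mathcal{H}$. *)

theory Defs
  imports "HOL-Analysis.Analysis"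
begin

section \<open>Complex Hilbert spaces\<close>

text \<open>
  The complex inner product is linear in its first argument.  Its real part is the inner product of
  the underlying \<^class>\<open>real_inner\<close>, which makes it positive definite and fixes
  the norm as \<open>norm x = sqrt (Re (cinner x x))\<close>.
\<close>

class complex_inner = real_inner +
  fixes scaleC :: "complex \<Rightarrow> 'a \<Rightarrow> 'a"  (infixr \<open>*\<^sub>C\<close> 75)
    and cinner :: "'a \<Rightarrow> 'a \<Rightarrow> complex"
  assumes scaleC_add_right: "c *\<^sub>C (x + y) = c *\<^sub>C x + c *\<^sub>C y"
    and scaleC_add_left: "(c + d) *\<^sub>C x = c *\<^sub>C x + d *\<^sub>C x"
    and scaleC_scaleC: "c *\<^sub>C d *\<^sub>C x = (c * d) *\<^sub>C x"
    and scaleC_complex_of_real: "complex_of_real r *\<^sub>C x = r *\<^sub>R x"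
    and cinner_commute: "cinner x y = cnj (cinner y x)"
    and cinner_add_left: "cinner (x + y) z = cinner x z + cinner y z"
    and cinner_scaleC_left: "cinner (c *\<^sub>C x) y = c * cinner x y"
    and Re_cinner: "Re (cinner x y) = inner x y"

class complex_hilbert = complex_inner + complete_space

lemma vector_space_scaleC:
  "vector_space (scaleC :: complex \<Rightarrow> 'a \<Rightarrow> 'a::complex_inner)"
proof
  show "1 *\<^sub>C x = x" for x :: 'a
    using scaleC_complex_of_real[of 1 x] by simp
qed (simp_all add: scaleC_add_right scaleC_add_left scaleC_scaleC)

global_interpretation complex_vector:
  vector_space "scaleC :: complex \<Rightarrow> 'a \<Rightarrow> 'a::complex_inner"
  defines csubspace_raw_def: csubspace = complex_vector.subspace
    and cspan_raw_def: cspan = complex_vector.span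
  by (rule vector_space_scaleC)

definition finite_cdim :: "'a::complex_inner itself \<Rightarrow> bool"
  where "finite_cdim _ \<longleftrightarrow> (\<exists>B::'a set. finite B \<and> cspan B = UNIV)"

definition is_onb :: "'a::complex_inner set \<Rightarrow> bool"
  where "is_onb E \<longleftrightarrow>
    (\<forall>x\<in>E. norm x = 1) \<and> (\<forall>x\<in>E. \<forall>y\<in>E. x \<noteq> y \<longrightarrow> cinner x y = 0) \<and>
    closure (cspan E) = UNIV"

definition is_onb_seq :: "(nat \<Rightarrow> 'a::complex_inner) \<Rightarrow> bool"
  where "is_onb_seq e \<longleftrightarrow> inj e \<and> is_onb (range e)"

section \<open>Bounded operators, adjoints and trace-class operators\<close>

definition bounded_clinear :: "('a::complex_inner \<Rightarrow> 'b::complex_inner) \<Rightarrow> bool"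
  where "bounded_clinear T \<longleftrightarrow> bounded_linear T \<and> (\<forall>c x. T (c *\<^sub>C x) = c *\<^sub>C T x)"

definition cadjoint :: "('a::complex_hilbert \<Rightarrow> 'a) \<Rightarrow> 'a \<Rightarrow> 'a"
  where "cadjoint T = (THE S. \<forall>x y. cinner (T x) y = cinner x (S y))"

definition positive_op :: "('a::complex_hilbert \<Rightarrow> 'a) \<Rightarrow> bool"
  where "positive_op P \<longleftrightarrow> bounded_clinear P \<and> (\<forall>x. cinner (P x) x \<in> \<real>\<^sub>\<ge>\<^sub>0)"

text \<open>The absolute value: the unique positive square root of the operator \<open>A\<^sup>* A\<close>.\<close>

definition abs_op :: "('a::complex_hilbert \<Rightarrow> 'a) \<Rightarrow> 'a \<Rightarrow> 'a"
  where "abs_op A = (THE P. positive_op P \<and> P \<circ> P = cadjoint A \<circ> A)"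

definition trace_class :: "('a::complex_hilbert \<Rightarrow> 'a) \<Rightarrow> bool"
  where "trace_class A \<longleftrightarrow> bounded_clinear A \<and>
    (\<exists>E. is_onb E \<and> (\<lambda>e. cinner (abs_op A e) e) summable_on E)"

text \<open>For a trace-class operator the sum exists and is the same for every orthonormal basis; the
  description below has no intended meaning for other operators.\<close>

definition op_trace :: "('a::complex_hilbert \<Rightarrow> 'a) \<Rightarrow> complex"
  where "op_trace A = (THE t. \<forall>E. is_onb E \<longrightarrow> ((\<lambda>e. cinner (A e) e) has_sum t) E)"

definition self_commutator :: "('a::complex_hilbert \<Rightarrow> 'a) \<Rightarrow> 'a \<Rightarrow> 'a"
  where "self_commutator T = (\<lambda>x. cadjoint T (T x) - T (cadjoint T x))"

section \<open>Hyperinvariant subspaces\<close>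

definition closed_csubspace :: "'a::complex_inner set \<Rightarrow> bool"
  where "closed_csubspace M \<longleftrightarrow> csubspace M \<and> closed M"

definition hyperinvariant :: "('a::complex_hilbert \<Rightarrow> 'a) \<Rightarrow> 'a set \<Rightarrow> bool"
  where "hyperinvariant T M \<longleftrightarrow> closed_csubspace M \<and>
    (\<forall>S. bounded_clinear S \<and> S \<circ> T = T \<circ> S \<longrightarrow> S ` M \<subseteq> M)"

definition nontrivial_subspace :: "'a::complex_inner set \<Rightarrow> bool"
  where "nontrivial_subspace M \<longleftrightarrow> M \<noteq> {0} \<and> M \<noteq> UNIV"

end

(*
  In the basis e, the operator T is a tridiagonal operator with subdiagonal a, diagonal d and
  superdiagonal b, plus an operator of finite rank.  Truncating the trace of the commutator shows
  that |a_n|^2 - |b_n|^2 tends to the trace; passing to the adjoint if necessary, the limit is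
  positive.  The first and second off-diagonals of the trace-class commutator are absolutely
  summable, and because |a_n| - |b_n| stays away from 0 this forces d_n and cnj b_n / a_n to have
  bounded variation.  Hence d_n converges to some l and |b_n| / |a_(n+1)| to some r < 1.  The
  eigenvector equation for T* at cnj l is therefore eventually a contractive recurrence, all of
  whose solutions are square summable; only finitely many linear equations remain, with one more
  unknown than equations.  So T* has an eigenvalue, and the orthogonal complement of the
  eigenspace is hyperinvariant for T.
*)
theory Submission
  imports Defs
begin

section \<open>Complex inner products\<close>

text \<open>The model is the unilateral shift: there \<open>a\<close> is 1, \<open>b\<close> and
  \<open>d\<close> vanish, the self-commutator has trace 1, and the adjoint has many eigenvectors.
  The obstacle is that the basis vectors may be multiplied by arbitrary phases, so \<open>a\<close>
  and \<open>b\<close> need not converge. Such a change leaves \<open>d\<close> and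
  \<open>cnj b / a\<close> fixed, which singles them out as the quantities that can have bounded
  variation. The recurrence, however, involves the ratio of \<open>b n\<close> to
  \<open>a (Suc n)\<close>, so the moduli of \<open>a\<close> must converge as well; this follows
  from the limit of \<open>|a|^2 - |b|^2\<close> once the limit of \<open>|b| / |a|\<close> is known
  to be strictly below 1. The operator theory is there because the absolute value and the trace are
  definite descriptions: existence and uniqueness of positive roots and basis independence come
  first. The order bounds of \<open>A\<close> by plus and minus its absolute value are what lets
  diagonal entries of the latter dominate off-diagonal entries of \<open>A\<close>.\<close>

instance complex_hilbert \<subseteq> banach ..

lemma cinner_add_right: "cinner x (y + z) = cinner x y + cinner x z"
  by (metis cinner_add_left cinner_commute complex_cnj_add)

lemma cinner_scaleC_right: "cinner x (c *\<^sub>C y) = cnj c * cinner x y"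
  by (metis cinner_commute cinner_scaleC_left complex_cnj_mult)

lemma cinner_zero_left [simp]: "cinner 0 x = 0"
  using cinner_add_left[of 0 0 x] by simp

lemma cinner_zero_right [simp]: "cinner x 0 = 0"
  using cinner_add_right[of x 0 0] by simp

lemma cinner_minus_left: "cinner (- x) y = - cinner x y"
  using cinner_add_left[of x "- x" y] by (simp add: eq_neg_iff_add_eq_0 add.commute)

lemma cinner_minus_right: "cinner x (- y) = - cinner x y"
  using cinner_add_right[of x y "- y"] by (simp add: eq_neg_iff_add_eq_0 add.commute)

lemma cinner_diff_left: "cinner (x - y) z = cinner x z - cinner y z"
  using cinner_add_left[of x "- y" z] by (simp add: cinner_minus_left)

lemma cinner_diff_right: "cinner x (y - z) = cinner x y - cinner x z"
  using cinner_add_right[of x y "- z"] by (simp add: cinner_minus_right)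

lemma cinner_sum_left: "cinner (sum f A) y = (\<Sum>a\<in>A. cinner (f a) y)"
  by (induction A rule: infinite_finite_induct) (simp_all add: cinner_add_left)

lemma cinner_sum_right: "cinner y (sum f A) = (\<Sum>a\<in>A. cinner y (f a))"
  by (induction A rule: infinite_finite_induct) (simp_all add: cinner_add_right)

lemma cinner_self: "cinner x x = complex_of_real ((norm x)\<^sup>2)"
proof -
  have "Im (cinner x x) = 0"
    using arg_cong[OF cinner_commute[of x x], of Im] by simp
  then show ?thesis
    by (simp add: complex_eq_iff Re_cinner dot_square_norm)
qed

lemma Im_cinner: "Im (cinner x y) = inner x (\<i> *\<^sub>C y)"
  by (simp flip: Re_cinner add: cinner_scaleC_right)

lemma norm_scaleC: "norm (c *\<^sub>C x) = cmod c * norm x"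
proof -
  have "complex_of_real ((norm (c *\<^sub>C x))\<^sup>2) = (c * cnj c) * cinner x x"
    unfolding cinner_self[symmetric] cinner_scaleC_left cinner_scaleC_right by simp
  also have "\<dots> = complex_of_real ((cmod c * norm x)\<^sup>2)"
    unfolding complex_norm_square[symmetric] cinner_self by (simp add: power_mult_distrib)
  finally have "complex_of_real ((norm (c *\<^sub>C x))\<^sup>2) = complex_of_real ((cmod c * norm x)\<^sup>2)" .
  then have "(norm (c *\<^sub>C x))\<^sup>2 = (cmod c * norm x)\<^sup>2"
    by (simp only: of_real_eq_iff)
  then show ?thesis by simp
qed

lemma norm_cinner_le: "cmod (cinner x y) \<le> norm x * norm y"
proof (cases "cinner x y = 0")
  case False
  define c where "c = cnj (sgn (cinner x y))"
  have "c * cinner x y = complex_of_real ((cmod (cinner x y))\<^sup>2) / complex_of_real (cmod (cinner x y))"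
    unfolding complex_norm_square c_def sgn_eq by (simp add: mult.commute)
  also have "\<dots> = complex_of_real (cmod (cinner x y))"
    by (simp add: power2_eq_square)
  finally have "cmod (cinner x y) = Re (cinner (c *\<^sub>C x) y)"
    by (simp add: cinner_scaleC_left)
  also have "\<dots> \<le> norm (c *\<^sub>C x) * norm y"
    by (simp add: Re_cinner norm_cauchy_schwarz)
  also have "\<dots> = norm x * norm y"
    using False by (simp add: norm_scaleC c_def norm_sgn)
  finally show ?thesis .
qed simp

lemma bounded_linear_cinner_left: "bounded_linear (\<lambda>x. cinner x y)"
proof (rule bounded_linear_intro[where K = "norm y"])
  show "cinner (r *\<^sub>R x) y = r *\<^sub>R cinner x y" for r x
    by (simp flip: scaleC_complex_of_real add: cinner_scaleC_left scaleR_conv_of_real)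
qed (simp_all add: cinner_add_left norm_cinner_le)

lemma bounded_linear_scaleC: "bounded_linear (\<lambda>x. c *\<^sub>C x)"
proof (rule bounded_linear_intro[where K = "cmod c"])
  show "c *\<^sub>C (r *\<^sub>R x) = r *\<^sub>R (c *\<^sub>C x)" for r and x :: 'a
    by (simp add: scaleC_scaleC mult.commute flip: scaleC_complex_of_real)
qed (simp_all add: scaleC_add_right norm_scaleC mult.commute)

section \<open>Square roots of positive operators\<close>

definition self_adjoint :: "('a::real_inner \<Rightarrow>\<^sub>L 'a) \<Rightarrow> bool"
  where "self_adjoint A \<longleftrightarrow> (\<forall>x y. inner (A x) y = inner x (A y))"

definition positive_blinfun :: "('a::real_inner \<Rightarrow>\<^sub>L 'a) \<Rightarrow> bool"
  where "positive_blinfun A \<longleftrightarrow> self_adjoint A \<and> (\<forall>x. 0 \<le> inner (A x) x)"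

lemma self_adjointD: "self_adjoint A \<Longrightarrow> inner (A x) y = inner x (A y)"
  by (simp add: self_adjoint_def)

lemma positive_blinfunD:
  assumes "positive_blinfun A"
  shows "self_adjoint A" "0 \<le> inner (A x) x"
  using assms by (simp_all add: positive_blinfun_def)

lemma blinfun_compose_assoc: "(A o\<^sub>L B) o\<^sub>L C = A o\<^sub>L (B o\<^sub>L C)"
  by (rule blinfun_eqI) simp

lemma blinfun_compose_eqD:
  assumes "A o\<^sub>L B = C o\<^sub>L D"
  shows "A (B x) = C (D x)"
  using arg_cong[OF assms, of "\<lambda>A. blinfun_apply A x"] by simp

text \<open>Positivity is tested on \<open>k *\<^sub>R x - B x\<close> with
  \<open>k = norm B\<close>; the quadratic term then absorbs half of the cross term. The estimate
  yields contractivity of \<open>X\<close> in the construction of roots, and shows that a zero of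
  the quadratic form lies in the kernel.\<close>

lemma positive_blinfun_norm_le:
  assumes "positive_blinfun B"
  shows "(norm (B x))\<^sup>2 \<le> norm B * inner (B x) x"
proof (cases "B = 0")
  case False
  define k where "k = norm B"
  have k: "k > 0" using False by (simp add: k_def)
  have sa: "inner (B y) z = inner y (B z)" for y z
    using assms by (simp add: positive_blinfun_def self_adjoint_def)
  have "inner (B (B x)) (B x) \<le> norm (B (B x)) * norm (B x)"
    by (rule norm_cauchy_schwarz)
  also have "\<dots> \<le> k * (norm (B x))\<^sup>2"
    using norm_blinfun[of B "B x"] by (simp add: k_def power2_eq_square mult_right_mono flip: mult.assoc)
  finally have 1: "inner (B (B x)) (B x) \<le> k * (norm (B x))\<^sup>2" .
  have "0 \<le> inner (B (k *\<^sub>R x - B x)) (k *\<^sub>R x - B x)"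
    using assms by (simp add: positive_blinfun_def)
  also have "\<dots> = k\<^sup>2 * inner (B x) x - 2 * k * (norm (B x))\<^sup>2 + inner (B (B x)) (B x)"
    unfolding power2_norm_eq_inner blinfun.diff_right blinfun.scaleR_right
    by (simp add: inner_diff_left inner_diff_right sa power2_eq_square algebra_simps)
  finally have "0 \<le> k * (k * inner (B x) x - (norm (B x))\<^sup>2)"
    using 1 by (simp add: power2_eq_square algebra_simps)
  then show ?thesis
    using k by (simp add: zero_le_mult_iff k_def)
qed simp

lemma positive_blinfun_eq_0:
  assumes "positive_blinfun B" "inner (B x) x = 0"
  shows "B x = 0"
  using positive_blinfun_norm_le[OF assms(1), of x] assms(2) by simp

text \<open>The iteration \<open>S \<mapsto> (X + S\<^sup>2) / 2\<close> started at 0 is dominated by the scalar iteration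
  \<open>t \<mapsto> (1 + t\<^sup>2) / 2\<close>. Its limit \<open>L\<close> satisfies \<open>(1 - L)\<^sup>2 = 1 - X\<close>; the closed sets \<open>K\<close> serve to transfer
  self-adjointness and commutation relations to \<open>L\<close>.\<close>

lemma quadratic_fixpoint:
  fixes X :: "'a::banach \<Rightarrow>\<^sub>L 'a"
  assumes "norm X \<le> 1"
  obtains L where "2 *\<^sub>R L = X + (L o\<^sub>L L)" "norm L \<le> 1"
    "\<And>K. closed K \<Longrightarrow> 0 \<in> K \<Longrightarrow> (\<And>S. S \<in> K \<Longrightarrow> (1/2) *\<^sub>R (X + (S o\<^sub>L S)) \<in> K) \<Longrightarrow> L \<in> K"
proof -
  define S where "S = rec_nat 0 (\<lambda>_ S. (1/2) *\<^sub>R (X + (S o\<^sub>L S)))"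
  define t :: "nat \<Rightarrow> real" where "t = rec_nat 0 (\<lambda>_ t. (1 + t\<^sup>2) / 2)"
  have S0: "S 0 = 0" and SS: "S (Suc n) = (1/2) *\<^sub>R (X + (S n o\<^sub>L S n))" for n
    by (simp_all add: S_def)
  have t0: "t 0 = 0" and tS: "t (Suc n) = (1 + (t n)\<^sup>2) / 2" for n
    by (simp_all add: t_def)
  have t01: "0 \<le> t n \<and> t n \<le> 1" for n
    by (induction n) (auto simp: t0 tS power_le_one)
  have t_mono: "t n \<le> t (Suc n)" for n
    using sum_power2_ge_zero[of "t n - 1" 0] by (simp add: tS power2_eq_square algebra_simps)
  have Sn: "norm (S n) \<le> t n" for n
  proof (induction n)
    case (Suc n)
    have "norm (S n o\<^sub>L S n) \<le> t n * t n"
      using norm_blinfun_compose[of "S n" "S n"] mult_mono[OF Suc Suc] t01[of n] by simp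
    then have "norm (X + (S n o\<^sub>L S n)) \<le> 1 + t n * t n"
      using norm_triangle_ineq[of X "S n o\<^sub>L S n"] assms by linarith
    then show ?case by (simp add: SS tS power2_eq_square)
  qed (simp add: S0 t0)
  \<comment> \<open>With \<open>norm X = 1\<close> allowed, the iteration need not contract by a
    fixed factor. Convergence comes instead from increments dominated by those of \<open>t\<close>,
    which telescope to a bounded monotone sequence. The difference of noncommuting squares is split
    as \<open>S (Suc n)\<close> times \<open>?D\<close> plus \<open>?D\<close> times
    \<open>S n\<close>.\<close>
  have diff: "norm (S (Suc n) - S n) \<le> t (Suc n) - t n" for n
  proof (induction n)
    case 0
    show ?case using assms by (simp add: SS S0 tS t0)
  next
    case (Suc n)
    let ?D = "S (Suc n) - S n"
    have "S (Suc (Suc n)) - S (Suc n) = (1/2) *\<^sub>R ((S (Suc n) o\<^sub>L ?D) + (?D o\<^sub>L S n))"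
      unfolding SS[of "Suc n"] SS[of n]
      by (rule blinfun_eqI) (simp add: blinfun.bilinear_simps SS algebra_simps)
    moreover have "norm (S (Suc n) o\<^sub>L ?D) \<le> t (Suc n) * (t (Suc n) - t n)"
      using norm_blinfun_compose[of "S (Suc n)" ?D] mult_mono[OF Sn[of "Suc n"] Suc] t01[of "Suc n"]
      by simp
    moreover have "norm (?D o\<^sub>L S n) \<le> (t (Suc n) - t n) * t n"
      using norm_blinfun_compose[of ?D "S n"] mult_mono[OF Suc Sn[of n]] t_mono[of n] by simp
    ultimately have "norm (S (Suc (Suc n)) - S (Suc n))
        \<le> (t (Suc n) * (t (Suc n) - t n) + (t (Suc n) - t n) * t n) / 2"
      using norm_triangle_ineq[of "S (Suc n) o\<^sub>L ?D" "?D o\<^sub>L S n"] by simp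
    also have "\<dots> = t (Suc (Suc n)) - t (Suc n)"
      by (simp add: tS[of "Suc n"]) (simp add: tS power2_eq_square field_simps)
    finally show ?case .
  qed
  have "incseq t" using t_mono by (rule incseq_SucI)
  moreover have "bdd_above (range t)" using t01 by (auto intro!: bdd_aboveI[of _ 1])
  ultimately have "convergent t"
    using incseq_convergent[of t 1] t01 by (metis convergent_def)
  then have "summable (\<lambda>n. t (Suc n) - t n)"
    by (auto simp: convergent_def intro: telescope_summable)
  then have "summable (\<lambda>n. S (Suc n) - S n)"
    by (rule summable_comparison_test'[where N = 0]) (use diff in auto)
  then have "convergent (\<lambda>n. \<Sum>i<n. S (Suc i) - S i)"
    by (simp add: summable_iff_convergent)
  then obtain L where L: "S \<longlonglongrightarrow> L"
    by (auto simp: convergent_def sum_lessThan_telescope S0)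
  have "(\<lambda>n. S (Suc n)) \<longlonglongrightarrow> (1/2) *\<^sub>R (X + (L o\<^sub>L L))"
    unfolding SS by (intro tendsto_intros bounded_bilinear.tendsto[OF bounded_bilinear_blinfun_compose] L)
  then have "L = (1/2) *\<^sub>R (X + (L o\<^sub>L L))"
    using LIMSEQ_unique[OF LIMSEQ_Suc[OF L]] by blast
  then have "2 *\<^sub>R L = 2 *\<^sub>R ((1/2) *\<^sub>R (X + (L o\<^sub>L L)))"
    by (rule arg_cong)
  then have "2 *\<^sub>R L = X + (L o\<^sub>L L)"
    by simp
  moreover have "norm L \<le> 1"
    using Lim_bounded[OF tendsto_norm[OF L], of 0 1] Sn t01 order_trans by blast
  moreover have "L \<in> K"
    if "closed K" "0 \<in> K" "\<And>S. S \<in> K \<Longrightarrow> (1/2) *\<^sub>R (X + (S o\<^sub>L S)) \<in> K" for K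
  proof -
    have "S n \<in> K" for n
      by (induction n) (auto simp: S0 SS that)
    then show ?thesis using closed_sequentially[OF that(1) _ L] by blast
  qed
  ultimately show thesis by (rule that)
qed

lemma closed_self_adjoint: "closed {A :: 'a::real_inner \<Rightarrow>\<^sub>L 'a. self_adjoint A}"
  unfolding self_adjoint_def
  by (intro closed_Collect_all closed_Collect_eq continuous_intros)

text \<open>With \<open>X = 1 - B/k\<close> the fixpoint satisfies \<open>(1 - L)^2 = B/k\<close>,
  so \<open>sqrt k\<close> times \<open>1 - L\<close> is a root. The commutation clause is kept
  because both uniqueness and complex linearity of the root are derived from it.\<close>

lemma positive_sqrt_exists:
  fixes B :: "'a::{real_inner,banach} \<Rightarrow>\<^sub>L 'a"
  assumes "positive_blinfun B"
  obtains R where "positive_blinfun R" "R o\<^sub>L R = B" "\<And>C. C o\<^sub>L B = B o\<^sub>L C \<Longrightarrow> C o\<^sub>L R = R o\<^sub>L C"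
proof -
  \<comment> \<open>The added 1 keeps \<open>k\<close> positive when \<open>B = 0\<close>.\<close>
  define k where "k = norm B + 1"
  have k: "k > 0" by (simp add: k_def add_nonneg_pos)
  define X where "X = id_blinfun - (1/k) *\<^sub>R B"
  have X_apply: "X x = x - (1/k) *\<^sub>R B x" for x
    by (simp add: X_def blinfun.bilinear_simps)
  have sa: "inner (B x) y = inner x (B y)" and pos: "0 \<le> inner (B x) x" for x y
    using assms by (auto simp: positive_blinfun_def self_adjoint_def)
  have "norm (X x) \<le> norm x" for x
  proof -
    have "(norm (B x))\<^sup>2 \<le> k * inner (B x) x"
      using positive_blinfun_norm_le[OF assms, of x] pos[of x] by (simp add: k_def algebra_simps)
    moreover have "(norm (X x))\<^sup>2 = (norm x)\<^sup>2 - 2 * (1/k) * inner (B x) x + (1/k)\<^sup>2 * (norm (B x))\<^sup>2"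
      unfolding power2_norm_eq_inner X_apply
      by (simp add: inner_diff_left inner_diff_right inner_commute power2_eq_square)
    then have "(norm (X x))\<^sup>2 = (norm x)\<^sup>2 - 2 / k * inner (B x) x + (norm (B x))\<^sup>2 / k\<^sup>2"
      by (simp add: power_divide)
    ultimately have "(norm (X x))\<^sup>2 \<le> (norm x)\<^sup>2 - 2 / k * inner (B x) x + k * inner (B x) x / k\<^sup>2"
      by (simp add: divide_right_mono)
    also have "\<dots> = (norm x)\<^sup>2 - inner (B x) x / k"
      using k by (simp add: field_simps power2_eq_square)
    also have "\<dots> \<le> (norm x)\<^sup>2"
      using pos[of x] k by simp
    finally show ?thesis by (rule power2_le_imp_le) simp
  qed
  then have "norm X \<le> 1"
    by (intro norm_blinfun_bound) auto
  then obtain L where L: "2 *\<^sub>R L = X + (L o\<^sub>L L)" "norm L \<le> 1"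
    and LK: "\<And>K. closed K \<Longrightarrow> 0 \<in> K \<Longrightarrow>
      (\<And>S. S \<in> K \<Longrightarrow> (1/2) *\<^sub>R (X + (S o\<^sub>L S)) \<in> K) \<Longrightarrow> L \<in> K"
    using quadratic_fixpoint[of X] by blast
  have "L \<in> {A. self_adjoint A}"
    by (rule LK[OF closed_self_adjoint])
      (auto simp: self_adjoint_def blinfun.bilinear_simps X_apply inner_simps sa)
  then have Lsa: "self_adjoint L" by simp
  define R where "R = sqrt k *\<^sub>R (id_blinfun - L)"
  have R_apply: "R x = sqrt k *\<^sub>R (x - L x)" for x
    by (simp add: R_def blinfun.bilinear_simps)
  have "positive_blinfun R"
    unfolding positive_blinfun_def self_adjoint_def
  proof (intro conjI allI)
    show "inner (R x) y = inner x (R y)" for x y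
      using Lsa by (simp add: self_adjoint_def R_apply inner_simps)
    have "inner (L x) x \<le> inner x x" for x
    proof -
      have "inner (L x) x \<le> norm (L x) * norm x" by (rule norm_cauchy_schwarz)
      also have "\<dots> \<le> norm x * norm x"
        using norm_blinfun[of L x] mult_right_mono[OF L(2), of "norm x"]
        by (intro mult_right_mono) auto
      finally show ?thesis by (simp add: power2_eq_square flip: power2_norm_eq_inner)
    qed
    then show "0 \<le> inner (R x) x" for x
      using k by (simp add: R_apply inner_simps)
  qed
  moreover have "R o\<^sub>L R = B"
  proof (rule blinfun_eqI)
    fix x
    have "2 *\<^sub>R L x = X x + L (L x)"
      using arg_cong[OF L(1), of "\<lambda>A. blinfun_apply A x"] by (simp add: blinfun.bilinear_simps)
    then have "x - 2 *\<^sub>R L x + L (L x) = (1/k) *\<^sub>R B x"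
      by (simp add: X_apply)
    moreover have "R (R x) = k *\<^sub>R (x - 2 *\<^sub>R L x + L (L x))"
      using k by (simp add: R_apply blinfun.bilinear_simps scaleR_2 scaleR_right_diff_distrib scaleR_add_right)
    ultimately show "(R o\<^sub>L R) x = B x"
      using k by simp
  qed
  moreover have "C o\<^sub>L R = R o\<^sub>L C" if "C o\<^sub>L B = B o\<^sub>L C" for C
  proof -
    have CB: "C (B x) = B (C x)" for x
      using arg_cong[OF that, of "\<lambda>A. blinfun_apply A x"] by simp
    have "L \<in> {A :: 'a \<Rightarrow>\<^sub>L 'a. \<forall>x. C (A x) = A (C x)}"
    proof (rule LK)
      show "closed {A :: 'a \<Rightarrow>\<^sub>L 'a. \<forall>x. C (A x) = A (C x)}"
        by (intro closed_Collect_all closed_Collect_eq continuous_intros)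
    qed (auto simp: blinfun.bilinear_simps X_apply CB)
    then have "C (L x) = L (C x)" for x
      by simp
    then show ?thesis
      by (intro blinfun_eqI) (simp add: R_apply blinfun.bilinear_simps)
  qed
  ultimately show thesis by (rule that)
qed

lemma positive_blinfun_square:
  assumes "self_adjoint A"
  shows "positive_blinfun (A o\<^sub>L A)"
  unfolding positive_blinfun_def self_adjoint_def
proof (intro conjI allI)
  show "0 \<le> inner ((A o\<^sub>L A) x) x" for x
    using self_adjointD[OF assms, of "A x" x] by simp
qed (simp add: self_adjointD[OF assms])

lemma self_adjoint_square_eq_0:
  assumes "self_adjoint N" "\<And>x. N (N x) = 0"
  shows "N x = 0"
  using self_adjointD[OF assms(1), of "x" "N x"] assms(2)[of x] by simp

text \<open>Every root is compared with the constructed root \<open>R\<close>. A root commutes with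
  its square, hence with \<open>R\<close>, so \<open>(R + P') (R - P') = 0\<close>. Two nonnegative
  forms then add up to zero on the range of \<open>N = R - P'\<close>; both operators vanish there,
  and \<open>N\<close> has square zero.\<close>

lemma positive_sqrt_unique:
  fixes P Q :: "'a::{real_inner,banach} \<Rightarrow>\<^sub>L 'a"
  assumes "positive_blinfun P" "positive_blinfun Q" "P o\<^sub>L P = Q o\<^sub>L Q"
  shows "P = Q"
proof -
  let ?B = "P o\<^sub>L P"
  have "positive_blinfun ?B"
    using assms(1) by (simp add: positive_blinfun_square positive_blinfunD)
  then obtain R where R: "positive_blinfun R" "R o\<^sub>L R = ?B"
    "\<And>C. C o\<^sub>L ?B = ?B o\<^sub>L C \<Longrightarrow> C o\<^sub>L R = R o\<^sub>L C"
    using positive_sqrt_exists by blast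
  have "P' = R" if P': "positive_blinfun P'" "P' o\<^sub>L P' = ?B" for P'
  proof (rule blinfun_eqI)
    fix x
    have "P' o\<^sub>L R = R o\<^sub>L P'"
      by (rule R(3)) (metis P'(2) blinfun_compose_assoc)
    then have comm: "P' (R x) = R (P' x)" for x
      by (rule blinfun_compose_eqD)
    have "P' o\<^sub>L P' = R o\<^sub>L R" using R(2) P'(2) by simp
    then have sq: "P' (P' x) = R (R x)" for x
      by (rule blinfun_compose_eqD)
    define N where "N = R - P'"
    have N_apply: "N x = R x - P' x" for x by (simp add: N_def blinfun.bilinear_simps)
    have Nsa: "self_adjoint N"
      using R(1) P'(1) by (auto simp: positive_blinfun_def self_adjoint_def N_apply inner_simps)
    have z: "R (N x) = 0" "P' (N x) = 0" for x
    proof -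
      have "R (N x) + P' (N x) = 0"
        by (simp add: N_apply blinfun.bilinear_simps comm sq)
      then have "inner (R (N x)) (N x) + inner (P' (N x)) (N x) = 0"
        by (simp flip: inner_add_left)
      then have "inner (R (N x)) (N x) = 0" "inner (P' (N x)) (N x) = 0"
        using positive_blinfunD(2)[OF R(1), of "N x"] positive_blinfunD(2)[OF P'(1), of "N x"]
        by linarith+
      then show "R (N x) = 0" "P' (N x) = 0"
        using positive_blinfun_eq_0 R(1) P'(1) by blast+
    qed
    have "N x = 0"
      by (rule self_adjoint_square_eq_0[OF Nsa]) (simp add: N_apply[of "N _"] z)
    then show "P' x = R x" by (simp add: N_apply)
  qed
  then show ?thesis using assms by metis
qed

text \<open>\<open>D = P - A\<close> satisfies \<open>D\<^sup>2 = 2PD\<close>, so \<open>D\<^sup>3 = 2DPD\<close> is positive and, by uniqueness of roots, equals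
  \<open>Q\<^sup>3\<close> for the positive root \<open>Q\<close> of \<open>D\<^sup>2\<close>.  This forces \<open>D = Q\<close>.\<close>

lemma positive_sqrt_dominates:
  fixes A P :: "'a::{real_inner,banach} \<Rightarrow>\<^sub>L 'a"
  assumes "self_adjoint A" "positive_blinfun P" "P o\<^sub>L P = A o\<^sub>L A"
  shows "positive_blinfun (P - A)"
proof -
  have posPP: "positive_blinfun (P o\<^sub>L P)"
    using assms(2) by (simp add: positive_blinfun_square positive_blinfunD)
  obtain P' where P': "positive_blinfun P'" "P' o\<^sub>L P' = P o\<^sub>L P"
    "\<And>C. C o\<^sub>L (P o\<^sub>L P) = (P o\<^sub>L P) o\<^sub>L C \<Longrightarrow> C o\<^sub>L P' = P' o\<^sub>L C"
    using positive_sqrt_exists[OF posPP] by blast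
  \<comment> \<open>Uniqueness hands the commutation property of the constructed root over to the
    given \<open>P\<close>; it applies to \<open>A\<close>, which commutes with its own
    square.\<close>
  have "P' = P" using positive_sqrt_unique P'(1,2) assms(2) by blast
  then have "A o\<^sub>L P = P o\<^sub>L A"
    using P'(3)[of A] by (simp add: assms(3) blinfun_compose_assoc)
  then have comm: "A (P x) = P (A x)" for x by (rule blinfun_compose_eqD)
  have sq: "P (P x) = A (A x)" for x
    using assms(3) by (rule blinfun_compose_eqD)
  define D where "D = P - A"
  have D_apply: "D x = P x - A x" for x by (simp add: D_def blinfun.bilinear_simps)
  have Dsa: "self_adjoint D"
    using assms by (auto simp: positive_blinfun_def self_adjoint_def D_apply inner_simps)
  note Dsa' = self_adjointD[OF Dsa]
  have DD: "D (D x) = 2 *\<^sub>R P (D x)" for x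
    by (simp add: D_apply blinfun.bilinear_simps comm sq scaleR_2)
  have "positive_blinfun (D o\<^sub>L D)"
    by (rule positive_blinfun_square[OF Dsa])
  then obtain Q where Q: "positive_blinfun Q" "Q o\<^sub>L Q = D o\<^sub>L D"
    "\<And>C. C o\<^sub>L (D o\<^sub>L D) = (D o\<^sub>L D) o\<^sub>L C \<Longrightarrow> C o\<^sub>L Q = Q o\<^sub>L C"
    using positive_sqrt_exists by blast
  note Qsa' = self_adjointD[OF positive_blinfunD(1)[OF Q(1)]]
  have "D o\<^sub>L Q = Q o\<^sub>L D" by (rule Q(3)) (simp add: blinfun_compose_assoc)
  then have DQ: "D (Q x) = Q (D x)" for x by (rule blinfun_compose_eqD)
  have QQ: "Q (Q x) = D (D x)" for x using Q(2) by (rule blinfun_compose_eqD)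
  have "Q o\<^sub>L Q o\<^sub>L Q = D o\<^sub>L D o\<^sub>L D"
  proof (rule positive_sqrt_unique)
    show "positive_blinfun (Q o\<^sub>L Q o\<^sub>L Q)"
      unfolding positive_blinfun_def self_adjoint_def
    proof (intro conjI allI)
      show "0 \<le> inner ((Q o\<^sub>L Q o\<^sub>L Q) x) x" for x
        using positive_blinfunD(2)[OF Q(1), of "Q x"] Qsa'[of "Q (Q x)" x] by simp
    qed (simp add: Qsa')
    have "0 \<le> inner (D (D (D x))) x" for x
      using positive_blinfunD(2)[OF assms(2), of "D x"]
      by (simp only: Dsa'[of _ x] DD) simp
    then show "positive_blinfun (D o\<^sub>L D o\<^sub>L D)"
      by (auto simp: positive_blinfun_def self_adjoint_def Dsa')
    show "(Q o\<^sub>L Q o\<^sub>L Q) o\<^sub>L (Q o\<^sub>L Q o\<^sub>L Q) = (D o\<^sub>L D o\<^sub>L D) o\<^sub>L (D o\<^sub>L D o\<^sub>L D)"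
      by (rule blinfun_eqI) (simp only: blinfun_apply_blinfun_compose QQ DQ)
  qed
  then have cube: "Q (Q (Q x)) = D (D (D x))" for x
    by (auto dest: blinfun_compose_eqD[of _ _ _ _ x])
  \<comment> \<open>\<open>Q\<close> and \<open>D\<close> agree in square and cube, so
    \<open>D\<close> squared annihilates the range of \<open>N\<close>. Self-adjointness lowers this
    to \<open>D\<close> and to \<open>Q\<close>, and hence \<open>N\<close> squared
    vanishes.\<close>
  define N where "N = Q - D"
  have N_apply: "N x = Q x - D x" for x by (simp add: N_def blinfun.bilinear_simps)
  have Nsa: "self_adjoint N"
    by (auto simp: self_adjoint_def N_apply inner_simps Qsa' Dsa')
  have DDN: "D (D (N x)) = 0" for x
    using cube[of x] by (simp add: N_apply blinfun.bilinear_simps QQ DQ)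
  have DN: "D (N x) = 0" for x
    using Dsa'[of "N x" "D (N x)"] DDN[of x] by simp
  have QN: "Q (N x) = 0" for x
    using Qsa'[of "N x" "Q (N x)"] DDN[of x] by (simp add: QQ)
  have "N x = 0" for x
    by (rule self_adjoint_square_eq_0[OF Nsa]) (simp add: N_apply[of "N _"] DN QN)
  then have "Q = D" by (intro blinfun_eqI) (simp add: N_apply)
  then show ?thesis using Q(1) by (simp add: D_def)
qed

section \<open>Complex-linear positive operators and the absolute value\<close>

lemma bounded_clinearD:
  assumes "bounded_clinear T"
  shows "bounded_linear T" "T (c *\<^sub>C x) = c *\<^sub>C T x"
  using assms by (simp_all add: bounded_clinear_def)

text \<open>The imaginary part is a real inner product with \<open>\<i>\<close> times the second
  argument, and \<open>S\<close> commutes with that multiplication.\<close>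

lemma cinner_eq_if_inner_eq:
  assumes "bounded_clinear S" "\<And>x y. inner (T x) y = inner x (S y)"
  shows "cinner (T x) y = cinner x (S y)"
proof (rule complex_eqI)
  show "Re (cinner (T x) y) = Re (cinner x (S y))"
    by (simp add: Re_cinner assms(2))
  show "Im (cinner (T x) y) = Im (cinner x (S y))"
    by (simp add: Im_cinner assms(2) bounded_clinearD(2)[OF assms(1)])
qed

text \<open>The real notion includes symmetry, the complex one does not. Over the complex numbers
  symmetry is automatic: polarise the vanishing imaginary part of the quadratic form, then replace
  \<open>x\<close> by \<open>\<i> *\<^sub>C x\<close> to reach the real part.\<close>

lemma positive_op_iff:
  assumes "bounded_clinear P"
  shows "positive_op P \<longleftrightarrow> positive_blinfun (Blinfun P)"
proof -
  have P: "blinfun_apply (Blinfun P) = P"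
    by (rule bounded_linear_Blinfun_apply[OF bounded_clinearD(1)[OF assms]])
  show ?thesis
  proof
    assume pos: "positive_op P"
    have re: "Im (cinner (P x) x) = 0" "0 \<le> Re (cinner (P x) x)" for x
      using pos by (auto simp: positive_op_def complex_nonneg_Reals_iff)
    have P_add: "P (x + y) = P x + P y" for x y
      using bounded_clinearD(1)[OF assms] by (simp add: linear_add bounded_linear.linear)
    have *: "Im (cinner (P x) y) + Im (cinner (P y) x) = 0" for x y
      using re(1)[of "x + y"] by (simp add: P_add cinner_add_left cinner_add_right re)
    have "inner (P x) y = inner x (P y)" for x y
    proof -
      have "Re (cinner (P x) y) = Re (cinner (P y) x)"
        using *[of "\<i> *\<^sub>C x" y]
        by (simp add: bounded_clinearD(2)[OF assms] cinner_scaleC_left cinner_scaleC_right)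
      then show ?thesis by (simp add: Re_cinner inner_commute)
    qed
    then show "positive_blinfun (Blinfun P)"
      using re(2) by (simp add: positive_blinfun_def self_adjoint_def P Re_cinner)
  next
    assume "positive_blinfun (Blinfun P)"
    then have sa: "inner (P x) y = inner x (P y)" and nn: "0 \<le> inner (P x) x" for x y
      using positive_blinfunD[of "Blinfun P"] self_adjointD[of "Blinfun P"] by (simp_all add: P)
    have "cinner (P x) x = cnj (cinner (P x) x)" for x
      using cinner_eq_if_inner_eq[OF assms sa] by (metis cinner_commute)
    then have "Im (cinner (P x) x) = 0" for x
      by (metis complex_cnj_cancel_iff complex_is_Real_iff Reals_cnj_iff)
    then show "positive_op P"
      using assms nn by (auto simp: positive_op_def complex_nonneg_Reals_iff Re_cinner)
  qed
qed

lemma cadjoint_eq: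
  assumes "\<And>x y. cinner (T x) y = cinner x (S y)"
  shows "cadjoint T = S"
  unfolding cadjoint_def
proof (rule the_equality)
  fix S' assume S': "\<forall>x y. cinner (T x) y = cinner x (S' y)"
  show "S' = S"
  proof
    fix y
    have "cinner (S' y - S y) (S' y - S y) = 0"
      by (metis S' assms cinner_diff_right diff_self)
    then show "S' y = S y" by (simp add: cinner_self)
  qed
qed (use assms in auto)

lemma bounded_clinear_if_commutes:
  fixes R :: "'a::complex_inner \<Rightarrow>\<^sub>L 'a"
  assumes "R o\<^sub>L Blinfun (scaleC \<i>) = Blinfun (scaleC \<i>) o\<^sub>L R"
  shows "bounded_clinear (blinfun_apply R)"
  unfolding bounded_clinear_def
proof (intro conjI allI)
  fix c x
  have R: "R (\<i> *\<^sub>C x) = \<i> *\<^sub>C R x" for x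
    using blinfun_compose_eqD[OF assms, of x]
    by (simp add: bounded_linear_Blinfun_apply[OF bounded_linear_scaleC])
  have c: "c *\<^sub>C x = Re c *\<^sub>R x + Im c *\<^sub>R (\<i> *\<^sub>C x)" for x :: 'a
    by (simp flip: scaleC_complex_of_real scaleC_add_left
        add: scaleC_scaleC mult.commute[of _ \<i>] complex_eq[of c, symmetric])
  show "R (c *\<^sub>C x) = c *\<^sub>C R x"
    by (simp add: c[of x] c[of "R x"] R blinfun.bilinear_simps)
qed (rule blinfun.bounded_linear_right)

text \<open>The real root of \<open>B\<close> commutes with multiplication by \<open>\<i>\<close>
  because \<open>B\<close> does, so it is complex linear. Existence and uniqueness together give the
  description in \<open>abs_op\<close> its meaning.\<close>

lemma positive_op_sqrt:
  fixes B :: "'a::complex_hilbert \<Rightarrow> 'a"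
  assumes "positive_op B"
  shows "\<exists>!P. positive_op P \<and> P \<circ> P = B"
proof -
  have B: "bounded_clinear B" using assms by (simp add: positive_op_def)
  have B_apply: "blinfun_apply (Blinfun B) = B"
    by (rule bounded_linear_Blinfun_apply[OF bounded_clinearD(1)[OF B]])
  have "positive_blinfun (Blinfun B)"
    using positive_op_iff[OF B] assms by simp
  then obtain R where R: "positive_blinfun R" "R o\<^sub>L R = Blinfun B"
    "\<And>C. C o\<^sub>L Blinfun B = Blinfun B o\<^sub>L C \<Longrightarrow> C o\<^sub>L R = R o\<^sub>L C"
    using positive_sqrt_exists by blast
  have "Blinfun (scaleC \<i>) o\<^sub>L R = R o\<^sub>L Blinfun (scaleC \<i>)"
    by (rule R(3), rule blinfun_eqI)
      (simp add: bounded_linear_Blinfun_apply[OF bounded_linear_scaleC] B_apply bounded_clinearD(2)[OF B])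
  then have cR: "bounded_clinear (blinfun_apply R)"
    by (intro bounded_clinear_if_commutes) simp
  show ?thesis
  proof (rule ex1I[of _ "blinfun_apply R"])
    have "R (R x) = B x" for x
      using arg_cong[OF R(2), of "\<lambda>A. blinfun_apply A x"] by (simp add: B_apply)
    then show "positive_op (blinfun_apply R) \<and> blinfun_apply R \<circ> blinfun_apply R = B"
      using R(1) by (auto simp: positive_op_iff[OF cR] blinfun_apply_inverse)
  next
    fix P assume P: "positive_op P \<and> P \<circ> P = B"
    then have cP: "bounded_clinear P" by (simp add: positive_op_def)
    have P_apply: "blinfun_apply (Blinfun P) = P"
      by (rule bounded_linear_Blinfun_apply[OF bounded_clinearD(1)[OF cP]])
    have "Blinfun P = R"
    proof (rule positive_sqrt_unique)
      show "Blinfun P o\<^sub>L Blinfun P = R o\<^sub>L R"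
        unfolding R(2) using P by (intro blinfun_eqI) (auto simp: P_apply B_apply)
    qed (use P R(1) positive_op_iff[OF cP] in auto)
    then show "P = blinfun_apply R" using P_apply by simp
  qed
qed

lemma positive_op_self_adjoint:
  assumes "positive_op P"
  shows "cinner (P x) y = cinner x (P y)"
proof -
  have P: "bounded_clinear P" using assms by (simp add: positive_op_def)
  have "self_adjoint (Blinfun P)"
    using positive_op_iff[OF P] assms positive_blinfunD(1) by blast
  then show ?thesis
    using cinner_eq_if_inner_eq[OF P, of P]
    by (simp add: self_adjoint_def bounded_linear_Blinfun_apply[OF bounded_clinearD(1)[OF P]])
qed

lemma bounded_clinear_diff:
  assumes "bounded_clinear A" "bounded_clinear B"
  shows "bounded_clinear (\<lambda>x. A x - B x)"
  using assms by (simp add: bounded_clinear_def bounded_linear_sub complex_vector.scale_right_diff_distrib)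

lemma bounded_clinear_compose:
  assumes "bounded_clinear A" "bounded_clinear B"
  shows "bounded_clinear (\<lambda>x. A (B x))"
  using assms by (simp add: bounded_clinear_def bounded_linear_compose)

text \<open>\<open>A\<close> and its negative have the same square, so the positive root of that
  square dominates both.\<close>

lemma abs_op_self_adjoint:
  fixes A :: "'a::complex_hilbert \<Rightarrow> 'a"
  assumes "bounded_clinear A" "\<And>x y. cinner (A x) y = cinner x (A y)"
  shows "positive_op (abs_op A)" "positive_op (\<lambda>x. abs_op A x - A x)" "positive_op (\<lambda>x. abs_op A x + A x)"
proof -
  have adj: "cadjoint A = A" by (rule cadjoint_eq) (rule assms(2))
  have "positive_op (A \<circ> A)"
    unfolding positive_op_def using bounded_clinear_compose[OF assms(1,1)]
    by (auto simp: o_def assms(2)[of "A _"] cinner_self complex_nonneg_Reals_iff)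
  from theI'[OF positive_op_sqrt[OF this]]
  have P: "positive_op (abs_op A)" "abs_op A \<circ> abs_op A = A \<circ> A"
    by (auto simp: abs_op_def adj)
  show "positive_op (abs_op A)" by fact
  have cP: "bounded_clinear (abs_op A)" using P by (simp add: positive_op_def)
  have dom: "positive_op (\<lambda>x. abs_op A x - C x)"
    if C: "bounded_clinear C" "\<And>x y. cinner (C x) y = cinner x (C y)" "C \<circ> C = A \<circ> A" for C
  proof -
    note C_apply = bounded_linear_Blinfun_apply[OF bounded_clinearD(1)[OF C(1)]]
    note P_apply = bounded_linear_Blinfun_apply[OF bounded_clinearD(1)[OF cP]]
    have "positive_blinfun (Blinfun (abs_op A) - Blinfun C)"
    proof (rule positive_sqrt_dominates)
      show "self_adjoint (Blinfun C)"
        by (simp add: self_adjoint_def C_apply C(2) flip: Re_cinner)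
      show "positive_blinfun (Blinfun (abs_op A))"
        using P(1) positive_op_iff[OF cP] by simp
      show "Blinfun (abs_op A) o\<^sub>L Blinfun (abs_op A) = Blinfun C o\<^sub>L Blinfun C"
        using P(2) C(3) by (intro blinfun_eqI) (auto simp: P_apply C_apply fun_eq_iff)
    qed
    moreover have "Blinfun (\<lambda>x. abs_op A x - C x) = Blinfun (abs_op A) - Blinfun C"
      by (rule blinfun_eqI) (simp add: blinfun.bilinear_simps P_apply C_apply
          bounded_linear_Blinfun_apply bounded_linear_sub bounded_clinearD(1) C(1) cP)
    ultimately show ?thesis
      using positive_op_iff[OF bounded_clinear_diff[OF cP C(1)]] by simp
  qed
  show "positive_op (\<lambda>x. abs_op A x - A x)"
    using assms by (intro dom) auto
  have "bounded_clinear (\<lambda>x. - A x)"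
    using assms(1) by (simp add: bounded_clinear_def bounded_linear_minus)
  then have "positive_op (\<lambda>x. abs_op A x - (- A x))"
    by (intro dom) (auto simp: cinner_minus_left cinner_minus_right assms(2) fun_eq_iff
        linear_neg bounded_linear.linear bounded_clinearD(1)[OF assms(1)])
  then show "positive_op (\<lambda>x. abs_op A x + A x)" by simp
qed

section \<open>Orthonormal bases and the trace\<close>

text \<open>The coefficients are arbitrary so that one identity serves twice:
  \<open>c u = cinner x u\<close> gives Bessel's inequality, and general \<open>c\<close> gives best
  approximation for Parseval.\<close>

lemma norm_diff_projection:
  assumes "finite G" "\<forall>u\<in>G. norm u = 1" "\<forall>u\<in>G. \<forall>v\<in>G. u \<noteq> v \<longrightarrow> cinner u v = 0"
  shows "(norm (x - (\<Sum>u\<in>G. c u *\<^sub>C u)))\<^sup>2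
    = (norm x)\<^sup>2 - (\<Sum>u\<in>G. (cmod (cinner x u))\<^sup>2) + (\<Sum>u\<in>G. (cmod (c u - cinner x u))\<^sup>2)"
proof -
  let ?p = "\<Sum>u\<in>G. c u *\<^sub>C u"
  have pu: "cinner ?p u = c u" if "u \<in> G" for u
  proof -
    have "cinner ?p u = (\<Sum>v\<in>G. if v = u then c u else 0)"
      unfolding cinner_sum_left using assms that
      by (intro sum.cong) (auto simp: cinner_scaleC_left cinner_self)
    then show ?thesis using assms(1) that by simp
  qed
  have xp: "cinner x ?p = (\<Sum>u\<in>G. cnj (c u) * cinner x u)"
    by (simp add: cinner_sum_right cinner_scaleC_right)
  have px: "cinner ?p x = (\<Sum>u\<in>G. c u * cnj (cinner x u))"
    unfolding cinner_sum_left cinner_scaleC_left by (simp flip: cinner_commute)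
  have pp: "cinner ?p ?p = (\<Sum>u\<in>G. cnj (c u) * c u)"
    unfolding cinner_sum_right[of ?p] cinner_scaleC_right using pu by simp
  have "complex_of_real ((norm (x - ?p))\<^sup>2) = cinner x x - (\<Sum>u\<in>G. cnj (c u) * cinner x u)
      - (\<Sum>u\<in>G. c u * cnj (cinner x u)) + (\<Sum>u\<in>G. cnj (c u) * c u)"
    unfolding cinner_self[symmetric] cinner_diff_left cinner_diff_right xp px pp by simp
  also have "\<dots> = cinner x x - (\<Sum>u\<in>G. cinner x u * cnj (cinner x u))
      + (\<Sum>u\<in>G. (c u - cinner x u) * cnj (c u - cinner x u))"
    by (simp add: algebra_simps sum.distrib sum_subtractf)
  finally have "complex_of_real ((norm (x - ?p))\<^sup>2) = complex_of_real ((norm x)\<^sup>2 -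
      (\<Sum>u\<in>G. (cmod (cinner x u))\<^sup>2) + (\<Sum>u\<in>G. (cmod (c u - cinner x u))\<^sup>2))"
    by (simp only: cinner_self of_real_add of_real_diff of_real_sum complex_norm_square)
  then show ?thesis by (simp only: of_real_eq_iff)
qed

lemma bessel:
  assumes "finite G" "\<forall>u\<in>G. norm u = 1" "\<forall>u\<in>G. \<forall>v\<in>G. u \<noteq> v \<longrightarrow> cinner u v = 0"
  shows "(\<Sum>u\<in>G. (cmod (cinner x u))\<^sup>2) \<le> (norm x)\<^sup>2"
  using norm_diff_projection[OF assms, of x "cinner x"]
    zero_le_power2[of "norm (x - (\<Sum>u\<in>G. cinner x u *\<^sub>C u))"] by simp

lemma is_onb_bessel:
  assumes "is_onb E" "finite G" "G \<subseteq> E"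
  shows "(\<Sum>u\<in>G. (cmod (cinner x u))\<^sup>2) \<le> (norm x)\<^sup>2"
  using assms by (intro bessel) (auto simp: is_onb_def subset_iff)

lemma parseval:
  assumes "is_onb E"
  shows "((\<lambda>u. (cmod (cinner x u))\<^sup>2) has_sum (norm x)\<^sup>2) E"
  unfolding has_sum_def
proof (rule tendstoI)
  fix \<epsilon> :: real assume \<epsilon>: "\<epsilon> > 0"
  have "x \<in> closure (cspan E)" using assms by (simp add: is_onb_def)
  then obtain y where y: "y \<in> cspan E" "dist y x < sqrt \<epsilon>"
    using \<epsilon> by (meson closure_approachable real_sqrt_gt_zero)
  obtain G c where G: "finite G" "G \<subseteq> E" "y = (\<Sum>u\<in>G. c u *\<^sub>C u)"
    using y(1) by (auto simp: complex_vector.span_explicit)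
  show "\<forall>\<^sub>F F in finite_subsets_at_top E. dist (\<Sum>u\<in>F. (cmod (cinner x u))\<^sup>2) ((norm x)\<^sup>2) < \<epsilon>"
    unfolding eventually_finite_subsets_at_top
  proof (intro exI[of _ G] conjI allI impI)
    fix F assume F: "finite F \<and> G \<subseteq> F \<and> F \<subseteq> E"
    \<comment> \<open>Padding by zero turns the approximant \<open>y\<close> into a combination over
      \<open>F\<close>; the projection onto the span of \<open>F\<close> is at least as close to
      \<open>x\<close>.\<close>
    define c' where "c' u = (if u \<in> G then c u else 0)" for u
    have y': "y = (\<Sum>u\<in>F. c' u *\<^sub>C u)"
      unfolding G(3) using F by (intro sum.mono_neutral_cong_left) (auto simp: c'_def)
    have "(norm x)\<^sup>2 - (\<Sum>u\<in>F. (cmod (cinner x u))\<^sup>2) \<le> (norm (x - y))\<^sup>2"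
      unfolding y' using assms F
      by (subst norm_diff_projection) (auto simp: is_onb_def subset_iff intro!: sum_nonneg)
    also have "(norm (x - y))\<^sup>2 < (sqrt \<epsilon>)\<^sup>2"
      using y(2) by (intro power_strict_mono) (auto simp: dist_norm norm_minus_commute)
    finally show "dist (\<Sum>u\<in>F. (cmod (cinner x u))\<^sup>2) ((norm x)\<^sup>2) < \<epsilon>"
      using is_onb_bessel[OF assms, of F x] F \<epsilon> by (simp add: dist_real_def)
  qed (use G in auto)
qed

section \<open>Basis independence for positive operators\<close>

lemma has_sum_finite_sum:
  fixes f :: "'i \<Rightarrow> 'a \<Rightarrow> 'b::topological_comm_monoid_add"
  assumes "finite G" "\<And>i. i \<in> G \<Longrightarrow> (f i has_sum s i) A"
  shows "((\<lambda>x. \<Sum>i\<in>G. f i x) has_sum (\<Sum>i\<in>G. s i)) A"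
  using assms by (induction G rule: finite_induct) (auto intro: has_sum_add)

text \<open>Both sums equal the double sum of the squared moduli of \<open>cinner (R e) f\<close>.
  Instead of interchanging infinite sums, a finite part of \<open>F\<close> is summed by Parseval in
  \<open>E\<close> and estimated by Bessel in \<open>F\<close>; the inequality is then used in both
  directions.\<close>

lemma hilbert_schmidt_has_sum:
  assumes onb: "is_onb E" "is_onb F"
    and sa: "\<And>x y. cinner (R x) y = cinner x (R y)"
    and sum: "((\<lambda>e. (norm (R e))\<^sup>2) has_sum s) E"
  shows "((\<lambda>e. (norm (R e))\<^sup>2) has_sum s) F"
proof -
  have bound: "(\<Sum>f\<in>G. (norm (R f))\<^sup>2) \<le> s"
    if onb: "is_onb E" "is_onb F" and sum: "((\<lambda>e. (norm (R e))\<^sup>2) has_sum s) E"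
      and G: "finite G" "G \<subseteq> F" for E F G s
  proof (rule has_sum_mono[OF has_sum_finite_sum[OF G(1)] sum])
    show "((\<lambda>e. (cmod (cinner (R f) e))\<^sup>2) has_sum (norm (R f))\<^sup>2) E" for f
      by (rule parseval[OF onb(1)])
    fix e
    have "cmod (cinner (R f) e) = cmod (cinner (R e) f)" for f
      by (metis cinner_commute complex_mod_cnj sa)
    then have "(\<Sum>f\<in>G. (cmod (cinner (R f) e))\<^sup>2) = (\<Sum>f\<in>G. (cmod (cinner (R e) f))\<^sup>2)"
      by simp
    also have "\<dots> \<le> (norm (R e))\<^sup>2"
      by (rule is_onb_bessel[OF onb(2) G])
    finally show "(\<Sum>f\<in>G. (cmod (cinner (R f) e))\<^sup>2) \<le> (norm (R e))\<^sup>2" .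
  qed
  have "(\<lambda>e. (norm (R e))\<^sup>2) summable_on F"
    using bound[OF onb sum] by (intro nonneg_bdd_above_summable_on) (auto intro!: bdd_aboveI2[of _ _ s])
  then obtain s' where s': "((\<lambda>e. (norm (R e))\<^sup>2) has_sum s') F"
    by (auto simp: summable_on_def)
  have le: "s2 \<le> s1"
    if "is_onb E" "is_onb F" "((\<lambda>e. (norm (R e))\<^sup>2) has_sum s1) E" "((\<lambda>e. (norm (R e))\<^sup>2) has_sum s2) F"
    for E F s1 s2
    using bound[OF that(1-3)] that(4) has_sum_infsum infsumI
    by (metis (no_types, lifting) has_sum_imp_summable infsum_le_finite_sums)
  have "s' = s"
    using le[OF onb sum s'] le[OF onb(2,1) s' sum] by simp
  then show ?thesis using s' by simp
qed

lemma positive_op_factor: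
  assumes "positive_op P"
  obtains R where "positive_op R" "\<And>x y. cinner (P x) y = cinner (R x) (R y)"
proof -
  obtain R where R: "positive_op R" "R \<circ> R = P"
    using positive_op_sqrt[OF assms] by blast
  have "cinner (P x) y = cinner (R x) (R y)" for x y
    using positive_op_self_adjoint[OF R(1), of "R x" y] R(2) by auto
  then show thesis using R(1) that by blast
qed

lemma positive_op_has_sum:
  assumes "is_onb E" "is_onb F" "positive_op P" "((\<lambda>e. Re (cinner (P e) e)) has_sum s) E"
  shows "((\<lambda>e. Re (cinner (P e) e)) has_sum s) F"
proof -
  obtain R where R: "positive_op R" "\<And>x y. cinner (P x) y = cinner (R x) (R y)"
    using positive_op_factor[OF assms(3)] by blast
  have "Re (cinner (P e) e) = (norm (R e))\<^sup>2" for e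
    by (simp add: R(2) cinner_self)
  then show ?thesis
    using hilbert_schmidt_has_sum[OF assms(1,2) positive_op_self_adjoint[OF R(1)]] assms(4) by simp
qed

lemma positive_op_nonneg:
  assumes "positive_op P"
  shows "0 \<le> Re (cinner (P x) x)" "Im (cinner (P x) x) = 0"
  using assms by (auto simp: positive_op_def complex_nonneg_Reals_iff)

text \<open>Cauchy-Schwarz for the form of \<open>P\<close>, written as
  \<open>cinner (R x) (R y)\<close>, followed by the arithmetic-geometric mean inequality. The
  additive form of the bound is the one that sums over a basis.\<close>

lemma cmod_cinner_positive_op_le:
  assumes "positive_op P"
  shows "2 * cmod (cinner (P x) y) \<le> Re (cinner (P x) x) + Re (cinner (P y) y)"
proof -
  obtain R where R: "positive_op R" "\<And>x y. cinner (P x) y = cinner (R x) (R y)"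
    using positive_op_factor[OF assms] by blast
  have "2 * cmod (cinner (P x) y) \<le> 2 * (norm (R x) * norm (R y))"
    using norm_cinner_le[of "R x" "R y"] by (simp add: R(2))
  also have "\<dots> \<le> (norm (R x))\<^sup>2 + (norm (R y))\<^sup>2"
    using sum_squares_bound[of "norm (R x)" "norm (R y)"] by simp
  finally show ?thesis by (simp add: R(2) cinner_self)
qed

section \<open>Self-adjoint trace-class operators: trace and matrix entries\<close>

context
  fixes A :: "'a::complex_hilbert \<Rightarrow> 'a"
  assumes tc: "trace_class A" and sa: "\<And>x y. cinner (A x) y = cinner x (A y)"
begin

private lemma bounded_clinear_A: "bounded_clinear A"
  using tc by (simp add: trace_class_def)

private lemmas pos = abs_op_self_adjoint[OF bounded_clinear_A sa]

text \<open>\<open>2 A\<close> is the difference of the positive operators \<open>?E\<close> and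
  \<open>?D\<close>, whose quadratic forms add up to twice that of \<open>abs_op A\<close>.\<close>

lemma cmod_cinner_self_adjoint_le:
  "2 * cmod (cinner (A x) y) \<le> Re (cinner (abs_op A x) x) + Re (cinner (abs_op A y) y)"
proof -
  let ?D = "\<lambda>x. abs_op A x - A x" and ?E = "\<lambda>x. abs_op A x + A x"
  have "2 * cinner (A x) y = cinner (?E x) y - cinner (?D x) y"
    by (simp add: cinner_add_left cinner_diff_left)
  then have "2 * cmod (cinner (A x) y) \<le> cmod (cinner (?E x) y) + cmod (cinner (?D x) y)"
    by (metis norm_mult norm_numeral norm_triangle_ineq4)
  then show ?thesis
    using cmod_cinner_positive_op_le[OF pos(2), of x y] cmod_cinner_positive_op_le[OF pos(3), of x y]
    by (simp add: cinner_add_left cinner_diff_left)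
qed

lemma abs_op_has_sum:
  obtains s where "\<And>E. is_onb E \<Longrightarrow> ((\<lambda>e. Re (cinner (abs_op A e) e)) has_sum s) E"
proof -
  obtain E0 where E0: "is_onb E0" "(\<lambda>e. cinner (abs_op A e) e) summable_on E0"
    using tc by (auto simp: trace_class_def)
  then have "(\<lambda>e. Re (cinner (abs_op A e) e)) summable_on E0"
    by (simp add: summable_on_Re)
  then obtain s where "((\<lambda>e. Re (cinner (abs_op A e) e)) has_sum s) E0"
    by (auto simp: summable_on_def)
  then have "((\<lambda>e. Re (cinner (abs_op A e) e)) has_sum s) E" if "is_onb E" for E
    using positive_op_has_sum[OF E0(1) that pos(1)] by blast
  then show thesis using that by blast
qed

text \<open>\<open>A\<close> is the difference of \<open>abs_op A\<close> and \<open>?D\<close>,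
  both positive with basis-independent traces; \<open>?D\<close> is summable because
  \<open>abs_op A + A\<close> is positive, which bounds it by twice \<open>abs_op A\<close>.\<close>

lemma op_trace_has_sum:
  assumes "is_onb F"
  shows "((\<lambda>e. cinner (A e) e) has_sum op_trace A) F"
proof -
  let ?D = "\<lambda>x. abs_op A x - A x"
  obtain s where s: "\<And>E. is_onb E \<Longrightarrow> ((\<lambda>e. Re (cinner (abs_op A e) e)) has_sum s) E"
    using abs_op_has_sum by blast
  have "(\<lambda>e. Re (cinner (?D e) e)) summable_on F"
  proof (rule summable_on_comparison_test)
    show "(\<lambda>e. 2 * Re (cinner (abs_op A e) e)) summable_on F"
      using s[OF assms] by (intro summable_on_cmult_right has_sum_imp_summable)
    show "Re (cinner (?D e) e) \<le> 2 * Re (cinner (abs_op A e) e)" for e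
      using positive_op_nonneg(1)[OF pos(3), of e] by (simp add: cinner_add_left cinner_diff_left)
  qed (use positive_op_nonneg(1)[OF pos(2)] in auto)
  then obtain d where "((\<lambda>e. Re (cinner (?D e) e)) has_sum d) F"
    by (auto simp: summable_on_def)
  then have d: "((\<lambda>e. Re (cinner (?D e) e)) has_sum d) E" if "is_onb E" for E
    using positive_op_has_sum[OF assms that pos(2)] by blast
  have "((\<lambda>e. cinner (A e) e) has_sum complex_of_real (s - d)) E" if "is_onb E" for E
  proof -
    have "cinner (A e) e = complex_of_real (Re (cinner (abs_op A e) e) - Re (cinner (?D e) e))" for e
      using positive_op_nonneg(2)[OF pos(1), of e] positive_op_nonneg(2)[OF pos(2), of e]
      by (simp add: cinner_diff_left complex_eq_iff)
    then show ?thesis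
      using has_sum_of_real[OF has_sum_add[OF s[OF that] has_sum_cmult_right[OF d[OF that], of "-1"]]]
      by simp
  qed
  then have "\<exists>!t. \<forall>E. is_onb E \<longrightarrow> ((\<lambda>e. cinner (A e) e) has_sum t) E"
    using assms by (metis has_sum_unique)
  from theI'[OF this] show ?thesis
    using assms by (auto simp: op_trace_def)
qed

lemma op_trace_sums:
  assumes "is_onb_seq e"
  shows "(\<lambda>n. cinner (A (e n)) (e n)) sums op_trace A"
proof -
  have "((\<lambda>e. cinner (A e) e) has_sum op_trace A) (range e)"
    using assms by (intro op_trace_has_sum) (simp add: is_onb_seq_def)
  then show ?thesis
    using assms by (auto simp: is_onb_seq_def has_sum_reindex o_def intro: has_sum_imp_sums)
qed

text \<open>Each entry is bounded by two diagonal entries of the absolute value, one of them shifted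
  by \<open>k\<close>.\<close>

lemma abs_summable_matrix_diagonal:
  assumes "is_onb_seq e"
  shows "summable (\<lambda>n. cmod (cinner (A (e n)) (e (n + k))))"
proof (rule summable_comparison_test')
  let ?p = "\<lambda>n. Re (cinner (abs_op A (e n)) (e n))"
  obtain s where s: "\<And>E. is_onb E \<Longrightarrow> ((\<lambda>e. Re (cinner (abs_op A e) e)) has_sum s) E"
    using abs_op_has_sum by blast
  have "summable ?p"
    using s[of "range e"] assms
    by (auto simp: is_onb_seq_def has_sum_reindex o_def dest!: has_sum_imp_sums sums_summable)
  then show "summable (\<lambda>n. ?p n + ?p (n + k))"
    by (intro summable_add summable_ignore_initial_segment)
  show "norm (cmod (cinner (A (e n)) (e (n + k)))) \<le> ?p n + ?p (n + k)" for n
    using cmod_cinner_self_adjoint_le[of "e n" "e (n + k)"] norm_ge_zero[of "cinner (A (e n)) (e (n + k))"]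
    unfolding real_norm_def abs_norm_cancel by linarith
qed

end

section \<open>Orthonormal sequences and adjoints\<close>

context
  fixes e :: "nat \<Rightarrow> 'a::complex_hilbert"
  assumes onb: "is_onb_seq e"
begin

lemma cinner_onb: "cinner (e m) (e n) = (if m = n then 1 else 0)"
  using onb by (auto simp: is_onb_seq_def is_onb_def inj_eq cinner_self)

lemma onb_parseval: "(\<lambda>n. (cmod (cinner x (e n)))\<^sup>2) sums (norm x)\<^sup>2"
proof -
  have "((\<lambda>u. (cmod (cinner x u))\<^sup>2) has_sum (norm x)\<^sup>2) (range e)"
    using onb by (intro parseval) (simp add: is_onb_seq_def)
  then show ?thesis
    using onb by (auto simp: is_onb_seq_def has_sum_reindex o_def intro: has_sum_imp_sums)
qed

lemma onb_bessel: "(\<Sum>n<M. (cmod (cinner x (e n)))\<^sup>2) \<le> (norm x)\<^sup>2"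
  using sum_le_suminf[OF sums_summable[OF onb_parseval], of "{..<M}" x] sums_unique[OF onb_parseval[of x]]
  by simp

lemma onb_eq_0:
  assumes "\<And>n. cinner x (e n) = 0"
  shows "x = 0"
  using onb_parseval[of x] by (simp add: assms sums_iff)

lemma norm_onb_sum:
  assumes "finite A"
  shows "(norm (\<Sum>n\<in>A. c n *\<^sub>C e n))\<^sup>2 = (\<Sum>n\<in>A. (cmod (c n))\<^sup>2)"
proof -
  let ?s = "\<Sum>n\<in>A. c n *\<^sub>C e n"
  have s: "cinner ?s (e m) = c m" if "m \<in> A" for m
    using assms that by (simp add: cinner_sum_left cinner_scaleC_left cinner_onb if_distrib cong: if_cong)
  have "complex_of_real ((norm ?s)\<^sup>2) = (\<Sum>n\<in>A. cnj (c n) * c n)"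
    unfolding cinner_self[symmetric] cinner_sum_right[of ?s] cinner_scaleC_right using s by simp
  also have "\<dots> = complex_of_real (\<Sum>n\<in>A. (cmod (c n))\<^sup>2)"
    unfolding of_real_sum complex_norm_square by (simp add: mult.commute)
  finally show ?thesis by (simp only: of_real_eq_iff)
qed

lemma onb_synthesis:
  assumes "\<And>M. (\<Sum>n<M. (cmod (c n))\<^sup>2) \<le> K"
  obtains v where "(\<lambda>n. c n *\<^sub>C e n) sums v" "\<And>n. cinner v (e n) = c n"
proof -
  have "summable (\<lambda>n. (cmod (c n))\<^sup>2)"
    by (rule bounded_imp_summable[of _ K]) (simp_all only: zero_le_power2 lessThan_Suc_atMost[symmetric] assms)
  have "summable (\<lambda>n. c n *\<^sub>C e n)"
    unfolding summable_Cauchy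
  proof (intro allI impI)
    fix \<epsilon> :: real assume \<epsilon>: "\<epsilon> > 0"
    then obtain N where N: "\<And>m n. m \<ge> N \<Longrightarrow> norm (\<Sum>k=m..<n. (cmod (c k))\<^sup>2) < \<epsilon>\<^sup>2"
      using \<open>summable (\<lambda>n. (cmod (c n))\<^sup>2)\<close> unfolding summable_Cauchy by (meson zero_less_power)
    have "norm (\<Sum>k=m..<n. c k *\<^sub>C e k) < \<epsilon>" if "m \<ge> N" for m n
      using N[OF that, of n] \<epsilon>
      by - (rule power2_less_imp_less, simp_all add: norm_onb_sum sum_nonneg)
    then show "\<exists>N. \<forall>m\<ge>N. \<forall>n. norm (\<Sum>k=m..<n. c k *\<^sub>C e k) < \<epsilon>" by blast
  qed
  then obtain v where v: "(\<lambda>n. c n *\<^sub>C e n) sums v" by (auto simp: summable_def)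
  have "cinner v (e n) = c n" for n
  proof -
    have "(\<lambda>m. cinner (c m *\<^sub>C e m) (e n)) sums cinner v (e n)"
      by (rule bounded_linear.sums[OF bounded_linear_cinner_left v])
    moreover have "(\<lambda>m. cinner (c m *\<^sub>C e m) (e n)) sums c n"
      using sums_single[of n c] by (simp add: cinner_scaleC_left cinner_onb if_distrib cong: if_cong)
    ultimately show ?thesis by (rule sums_unique2)
  qed
  then show thesis using v that by blast
qed

lemma onb_expansion: "(\<lambda>n. cinner x (e n) *\<^sub>C e n) sums x"
proof -
  obtain v where v: "(\<lambda>n. cinner x (e n) *\<^sub>C e n) sums v" "\<And>n. cinner v (e n) = cinner x (e n)"
    using onb_synthesis[OF onb_bessel] by blast
  have "v - x = 0" by (rule onb_eq_0) (simp add: cinner_diff_left v(2))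
  then show ?thesis using v(1) by simp
qed

lemma onb_cinner_finite:
  assumes "finite A" "\<And>m. m \<notin> A \<Longrightarrow> cinner x (e m) * cinner (e m) y = 0"
  shows "cinner x y = (\<Sum>m\<in>A. cinner x (e m) * cinner (e m) y)"
proof -
  have "(\<lambda>n. cinner (cinner x (e n) *\<^sub>C e n) y) sums cinner x y"
    by (rule bounded_linear.sums[OF bounded_linear_cinner_left onb_expansion])
  then show ?thesis
    using sums_unique2[OF _ sums_finite[OF assms]] by (simp add: cinner_scaleC_left)
qed

text \<open>Riesz representation in coordinates: the vector \<open>S y\<close> must have the
  coefficients \<open>cinner y (T (e n))\<close>, and only their square summability is at
  stake.\<close>

lemma adjoint_exists:
  fixes T :: "'a \<Rightarrow> 'a"
  assumes "bounded_clinear T"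
  obtains S where "bounded_clinear S" "\<And>x y. cinner (T x) y = cinner x (S y)"
proof -
  obtain K where K: "\<And>x. norm (T x) \<le> norm x * K" "K \<ge> 0"
    using bounded_linear.nonneg_bounded[OF bounded_clinearD(1)[OF assms]] by blast
  have T_sum: "T (\<Sum>n\<in>A. c n *\<^sub>C e n) = (\<Sum>n\<in>A. c n *\<^sub>C T (e n))" for A :: "nat set" and c
    using bounded_clinearD[OF assms] by (simp add: linear_sum bounded_linear.linear)
  have "\<exists>v. \<forall>x. cinner (T x) y = cinner x v" for y
  proof -
    let ?f = "\<lambda>n. cinner y (T (e n))"
    have "(\<Sum>n<M. (cmod (?f n))\<^sup>2) \<le> (norm y * K)\<^sup>2" for M
    proof -
      \<comment> \<open>Testing \<open>T\<close> on the truncated candidate itself gives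
        \<open>(norm w)\<^sup>2 = cinner y (T w)\<close>, and one factor \<open>norm w\<close>
        cancels from the resulting bound.\<close>
      define w where "w = (\<Sum>n<M. ?f n *\<^sub>C e n)"
      have w: "(norm w)\<^sup>2 = (\<Sum>n<M. (cmod (?f n))\<^sup>2)"
        by (simp add: w_def norm_onb_sum)
      have "cinner y (T w) = complex_of_real ((norm w)\<^sup>2)"
        unfolding w unfolding w_def T_sum cinner_sum_right cinner_scaleC_right of_real_sum complex_norm_square
        by (simp add: mult.commute)
      then have "(norm w)\<^sup>2 \<le> norm y * norm (T w)"
        using norm_cinner_le[of y "T w"] by (simp add: norm_power)
      also have "\<dots> \<le> norm y * (norm w * K)"
        by (intro mult_left_mono K) simp
      finally have "norm w * norm w \<le> norm w * (norm y * K)"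
        by (simp add: power2_eq_square mult_ac)
      then have "norm w \<le> norm y * K"
        using K(2) by (cases "norm w = 0") (auto simp: mult_le_cancel_left)
      then show ?thesis unfolding w[symmetric] by (intro power_mono) auto
    qed
    then obtain v where v: "\<And>n. cinner v (e n) = ?f n"
      using onb_synthesis[of ?f] by blast
    have "cinner (T x) y = cinner x v" for x
    proof -
      have "bounded_linear (\<lambda>x. cinner (T x) y)"
        using bounded_linear_compose[OF bounded_linear_cinner_left bounded_clinearD(1)[OF assms]] .
      from bounded_linear.sums[OF this onb_expansion]
      have "(\<lambda>n. cinner x (e n) * cinner (T (e n)) y) sums cinner (T x) y"
        by (simp add: bounded_clinearD(2)[OF assms] cinner_scaleC_left)
      moreover have "cinner (T (e n)) y = cinner (e n) v" for n
        by (metis cinner_commute v)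
      moreover have "(\<lambda>n. cinner (cinner x (e n) *\<^sub>C e n) v) sums cinner x v"
        by (rule bounded_linear.sums[OF bounded_linear_cinner_left onb_expansion])
      ultimately show ?thesis
        by (simp add: cinner_scaleC_left sums_unique2)
    qed
    then show ?thesis by blast
  qed
  then obtain S where S: "\<And>x y. cinner (T x) y = cinner x (S y)" by metis
  have eqI: "u = v" if "\<And>x. cinner x u = cinner x v" for u v :: 'a
  proof -
    have "cinner (u - v) (u - v) = 0"
      using that[of "u - v"] by (simp add: cinner_diff_right[of "u - v"])
    then show ?thesis by (simp add: cinner_self)
  qed
  have "bounded_clinear S"
    unfolding bounded_clinear_def
  proof (intro conjI allI)
    show S_scale: "S (c *\<^sub>C y) = c *\<^sub>C S y" for c y
      by (rule eqI) (simp add: cinner_scaleC_right flip: S)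
    show "bounded_linear S"
    proof (rule bounded_linear_intro[where K = K])
      show "S (x + y) = S x + S y" for x y
        by (rule eqI) (simp add: cinner_add_right flip: S)
      show "S (r *\<^sub>R x) = r *\<^sub>R S x" for r x
        using S_scale[of "complex_of_real r" x] by (simp add: scaleC_complex_of_real)
      fix y
      have "(norm (S y))\<^sup>2 = cmod (cinner (T (S y)) y)"
        unfolding S cinner_self by (simp add: norm_power)
      also have "\<dots> \<le> norm (S y) * K * norm y"
        by (rule order_trans[OF norm_cinner_le]) (intro mult_right_mono K(1) norm_ge_zero)
      finally have "norm (S y) * norm (S y) \<le> norm (S y) * (norm y * K)"
        by (simp add: power2_eq_square mult_ac)
      then show "norm (S y) \<le> norm y * K"
        using K(2) by (cases "norm (S y) = 0") (auto simp: mult_le_cancel_left)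
    qed
  qed
  then show thesis using S that by blast
qed

end

section \<open>Kernels of eventually tridiagonal operators\<close>

lemma L2_set_lessThan_Suc_le:
  fixes x :: "nat \<Rightarrow> complex"
  shows "L2_set (\<lambda>k. cmod (x k)) {..<Suc M} \<le> cmod (x 0) + L2_set (\<lambda>k. cmod (x (Suc k))) {..<M}"
  unfolding L2_set_def sum.lessThan_Suc_shift
  using sqrt_add_le_add_sqrt[of "(cmod (x 0))\<^sup>2" "\<Sum>k<M. (cmod (x (Suc k)))\<^sup>2"]
  by (simp add: sum_nonneg)

text \<open>By the triangle inequality in \<open>\<ell>\<^sup>2\<close>, the norm \<open>X\<close> of a finite section of a solution satisfies
  \<open>X \<le> |x\<^sub>0| + (\<epsilon> + q) X + F / c\<close>.\<close>

lemma contractive_recurrence_square_summable: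
  fixes \<alpha> \<delta> \<gamma> f :: "nat \<Rightarrow> complex" and x\<^sub>0 :: complex
  assumes c: "c > 0" "\<And>k. c \<le> cmod (\<alpha> k)"
    and \<delta>: "\<And>k. cmod (\<delta> k) \<le> \<epsilon> * cmod (\<alpha> k)" and \<gamma>: "\<And>k. cmod (\<gamma> k) \<le> q * cmod (\<alpha> k)"
    and q: "0 \<le> \<epsilon>" "0 \<le> q" "\<epsilon> + q < 1" and f: "\<And>M. L2_set (\<lambda>k. cmod (f k)) {..<M} \<le> F"
  obtains x K where "x 0 = x\<^sub>0"
    "\<And>k. \<alpha> k * x (Suc k) + \<delta> k * x k + \<gamma> k * (if k = 0 then 0 else x (k - 1)) + f k = 0"
    "\<And>M. L2_set (\<lambda>k. cmod (x k)) {..<M} \<le> K"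
proof -
  \<comment> \<open>The pair carries the two latest values; its first component starts as 0,
    standing for the absent predecessor of \<open>x\<^sub>0\<close>.\<close>
  define z where "z = rec_nat (0, x\<^sub>0) (\<lambda>k (u, v). (v, - (\<delta> k * v + \<gamma> k * u + f k) / \<alpha> k))"
  define x where "x k = snd (z k)" for k
  define x' where "x' k = (if k = 0 then 0 else x (k - 1))" for k
  have z_Suc: "z (Suc k) = (snd (z k), - (\<delta> k * snd (z k) + \<gamma> k * fst (z k) + f k) / \<alpha> k)" for k
    by (simp add: z_def case_prod_unfold)
  have fst_z: "fst (z k) = x' k" for k
    by (cases k) (simp_all add: x'_def x_def z_Suc, simp add: z_def)
  have x0: "x 0 = x\<^sub>0" by (simp add: x_def z_def)
  have x_Suc: "x (Suc k) = - (\<delta> k * x k + \<gamma> k * x' k + f k) / \<alpha> k" for k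
    unfolding fst_z[symmetric] by (simp add: x_def z_Suc)
  have \<alpha>0: "cmod (\<alpha> k) > 0" for k
    using c(1) c(2)[of k] by linarith
  have rec: "\<alpha> k * x (Suc k) + \<delta> k * x k + \<gamma> k * x' k + f k = 0" for k
    using \<alpha>0[of k] by (simp add: x_Suc)
  have x_le: "cmod (x (Suc k)) \<le> (\<epsilon> * cmod (x k) + q * cmod (x' k)) + (1 / c) * cmod (f k)" for k
  proof -
    have "cmod (x (Suc k)) = cmod (\<delta> k * x k + \<gamma> k * x' k + f k) / cmod (\<alpha> k)"
      unfolding x_Suc norm_divide norm_minus_cancel ..
    also have "\<dots> \<le> (cmod (\<delta> k) * cmod (x k) + cmod (\<gamma> k) * cmod (x' k) + cmod (f k)) / cmod (\<alpha> k)"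
      by (intro divide_right_mono norm_triangle_le add_mono) (simp_all add: norm_mult)
    also have "\<dots> = cmod (\<delta> k) / cmod (\<alpha> k) * cmod (x k) + cmod (\<gamma> k) / cmod (\<alpha> k) * cmod (x' k)
        + 1 / cmod (\<alpha> k) * cmod (f k)"
      by (simp add: add_divide_distrib)
    also have "\<dots> \<le> \<epsilon> * cmod (x k) + q * cmod (x' k) + 1 / c * cmod (f k)"
      using \<delta>[of k] \<gamma>[of k] c \<alpha>0[of k]
      by (intro add_mono mult_right_mono divide_left_mono) (auto simp: pos_divide_le_eq)
    finally show ?thesis .
  qed
  \<comment> \<open>\<open>K\<close> is the fixed point of the affine bound, so it reproduces itself
    in the induction on the length of the section.\<close>
  define K where "K = (cmod x\<^sub>0 + F / c) / (1 - \<epsilon> - q)"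
  have K_nonneg: "0 \<le> F" using f[of 0] by simp
  then have K0: "0 \<le> K" using q c(1) by (simp add: K_def)
  have K_eq: "cmod x\<^sub>0 + (\<epsilon> + q) * K + F / c = K"
  proof -
    have "K * (1 - \<epsilon> - q) = cmod x\<^sub>0 + F / c"
      using q by (simp add: K_def)
    then show ?thesis by (simp add: algebra_simps)
  qed
  have bound: "L2_set (\<lambda>k. cmod (x k)) {..<M} \<le> K" for M
  proof (induction M)
    case (Suc M)
    have x'_le: "L2_set (\<lambda>k. cmod (x' k)) {..<M} \<le> K"
    proof (cases M)
      case (Suc m)
      have "L2_set (\<lambda>k. cmod (x' k)) {..<Suc m} \<le> 0 + L2_set (\<lambda>k. cmod (x k)) {..<m}"
        using L2_set_lessThan_Suc_le[of x' m] by (simp add: x'_def)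
      also have "\<dots> \<le> L2_set (\<lambda>k. cmod (x k)) {..<M}"
        unfolding L2_set_def Suc by (simp add: sum_nonneg)
      finally show ?thesis using Suc.IH Suc by simp
    qed (simp add: K0)
    have "L2_set (\<lambda>k. cmod (x (Suc k))) {..<M}
        \<le> L2_set (\<lambda>k. (\<epsilon> * cmod (x k) + q * cmod (x' k)) + (1 / c) * cmod (f k)) {..<M}"
      by (rule L2_set_mono) (simp_all only: x_le norm_ge_zero)
    also have "\<dots> \<le> (L2_set (\<lambda>k. \<epsilon> * cmod (x k)) {..<M} + L2_set (\<lambda>k. q * cmod (x' k)) {..<M})
        + L2_set (\<lambda>k. (1 / c) * cmod (f k)) {..<M}"
      by (rule order_trans[OF L2_set_triangle_ineq]) (simp add: L2_set_triangle_ineq)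
    also have "\<dots> \<le> (\<epsilon> * K + q * K) + (1 / c) * F"
    proof -
      have "1 / c \<ge> 0" using c(1) by simp
      then show ?thesis
        using q Suc.IH x'_le f[of M]
        by (auto simp del: times_divide_eq_left simp flip: L2_set_right_distrib intro!: add_mono mult_left_mono)
    qed
    finally have "L2_set (\<lambda>k. cmod (x (Suc k))) {..<M} \<le> (\<epsilon> + q) * K + F / c"
      by (simp add: algebra_simps)
    then show ?case
      using L2_set_lessThan_Suc_le[of x M] K_eq unfolding x0 by linarith
  qed (simp add: K0)
  show thesis
    by (rule that[OF x0 _ bound]) (use rec in \<open>simp add: x'_def\<close>)
qed

text \<open>More vectors than coordinates: the last coordinate is eliminated with a pivot vector,
  and the induction hypothesis treats the remaining vectors.\<close>

lemma exists_linear_dependence: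
  fixes v :: "nat \<Rightarrow> nat \<Rightarrow> 'b::field"
  shows "\<exists>c. (\<exists>j\<le>N. c j \<noteq> 0) \<and> (\<forall>i<N. (\<Sum>j\<le>N. c j * v j i) = 0)"
proof (induction N arbitrary: v)
  case 0
  show ?case by (rule exI[of _ "\<lambda>_. 1"]) simp
next
  case (Suc N)
  show ?case
  proof (cases "v (Suc N) N = 0")
    case True
    show ?thesis
    proof (cases "\<forall>j\<le>N. v j N = 0")
      case all0: True
      obtain c where c: "\<exists>j\<le>N. c j \<noteq> 0" "\<forall>i<N. (\<Sum>j\<le>N. c j * v j i) = 0"
        using Suc.IH[of v] by blast
      have "(\<Sum>j\<le>Suc N. (if j \<le> N then c j else 0) * v j i) = (\<Sum>j\<le>N. c j * v j i)" for i
        by simp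
      moreover have "(\<Sum>j\<le>N. c j * v j N) = 0"
        using all0 by simp
      ultimately show ?thesis
        using c by (intro exI[of _ "\<lambda>j. if j \<le> N then c j else 0"]) (auto simp: less_Suc_eq)
    next
      case False
      then obtain p where p: "p \<le> N" "v p N \<noteq> 0" by blast
      \<comment> \<open>The pivot frees slot \<open>p\<close>, which the last vector occupies; in
        this branch its last coordinate is already 0. The family is thus again indexed by
        \<open>{..N}\<close>.\<close>
      define w where "w j i = (if j = p then v (Suc N) i else v j i - v j N / v p N * v p i)" for j i
      obtain c where c: "\<exists>j\<le>N. c j \<noteq> 0" "\<forall>i<N. (\<Sum>j\<le>N. c j * w j i) = 0"
        using Suc.IH[of w] by blast
      \<comment> \<open>Undoing the elimination: \<open>c p\<close> returns to the last vector, and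
        the pivot collects all the multiples that were subtracted.\<close>
      define d where "d j = (if j = Suc N then c p else
        if j = p then - (\<Sum>k\<in>{..N} - {p}. c k * v k N / v p N) else c j)" for j
      have split: "(\<Sum>j\<le>N. g j) = g p + (\<Sum>j\<in>{..N} - {p}. g j)" for g :: "nat \<Rightarrow> 'b"
        using p(1) by (intro sum.remove) auto
      have d_sum: "(\<Sum>j\<le>Suc N. d j * v j i) = (\<Sum>j\<le>N. c j * w j i)" for i
      proof -
        have "(\<Sum>j\<in>{..N} - {p}. d j * v j i) = (\<Sum>j\<in>{..N} - {p}. c j * v j i)"
          by (intro sum.cong) (auto simp: d_def)
        moreover have "(\<Sum>j\<in>{..N} - {p}. c j * w j i) = (\<Sum>j\<in>{..N} - {p}. c j * v j i)
            - (\<Sum>j\<in>{..N} - {p}. c j * v j N / v p N) * v p i"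
          unfolding sum_distrib_right sum_subtractf[symmetric]
          by (intro sum.cong) (auto simp: w_def algebra_simps)
        moreover have "d p = - (\<Sum>j\<in>{..N} - {p}. c j * v j N / v p N)" "d (Suc N) = c p"
          "w p i = v (Suc N) i"
          using p(1) by (auto simp: d_def w_def)
        ultimately show ?thesis
          unfolding sum.atMost_Suc split by simp
      qed
      have "w j N = 0" for j using p(2) True by (simp add: w_def)
      then have "(\<Sum>j\<le>N. c j * w j N) = 0"
        by simp
      moreover have "\<exists>j\<le>Suc N. d j \<noteq> 0"
      proof -
        obtain j where "j \<le> N" "c j \<noteq> 0" using c(1) by blast
        then have "d (if j = p then Suc N else j) \<noteq> 0" "(if j = p then Suc N else j) \<le> Suc N"
          by (auto simp: d_def)
        then show ?thesis by blast
      qed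
      ultimately show ?thesis
        using c(2) d_sum by (intro exI[of _ d]) (auto simp: less_Suc_eq)
    qed
  next
    case False
    define w where "w j i = v j i - v j N / v (Suc N) N * v (Suc N) i" for j i
    obtain c where c: "\<exists>j\<le>N. c j \<noteq> 0" "\<forall>i<N. (\<Sum>j\<le>N. c j * w j i) = 0"
      using Suc.IH[of w] by blast
    define d where "d j = (if j = Suc N then - (\<Sum>k\<le>N. c k * v k N / v (Suc N) N) else c j)" for j
    have "(\<Sum>j\<le>Suc N. d j * v j i) = (\<Sum>j\<le>N. c j * w j i)" for i
    proof -
      have "(\<Sum>j\<le>N. d j * v j i) = (\<Sum>j\<le>N. c j * v j i)"
        by (intro sum.cong) (auto simp: d_def)
      moreover have "(\<Sum>j\<le>N. c j * w j i) = (\<Sum>j\<le>N. c j * v j i)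
          - (\<Sum>j\<le>N. c j * v j N / v (Suc N) N) * v (Suc N) i"
        unfolding sum_distrib_right sum_subtractf[symmetric]
        by (intro sum.cong) (auto simp: w_def algebra_simps)
      ultimately show ?thesis by (simp add: d_def)
    qed
    moreover have "w j N = 0" for j using False by (simp add: w_def)
    moreover have "\<exists>j\<le>Suc N. d j \<noteq> 0"
    proof -
      obtain j where "j \<le> N" "c j \<noteq> 0" using c(1) by blast
      then have "d j \<noteq> 0" "j \<le> Suc N" by (auto simp: d_def)
      then show ?thesis by blast
    qed
    ultimately show ?thesis
      using c(2) by (intro exI[of _ d]) (auto simp: less_Suc_eq)
  qed
qed

lemma sum_lessThan_add:
  fixes g :: "nat \<Rightarrow> 'b::comm_monoid_add"
  shows "(\<Sum>n<N + M. g n) = (\<Sum>n<N. g n) + (\<Sum>k<M. g (N + k))"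
  by (induction M) (simp_all add: add.assoc)

context
  fixes e :: "nat \<Rightarrow> 'a::complex_hilbert"
  assumes onb: "is_onb_seq e"
begin

text \<open>Prescribing the first \<open>N + 1\<close> coordinates freely, the recurrence yields vectors \<open>w\<^sub>0, \<dots>, w\<^sub>N\<close> for which
  all coordinates of \<open>B w\<^sub>j\<close> from \<open>N\<close> on vanish; some combination also kills the first \<open>N\<close> coordinates.\<close>

lemma eventually_tridiagonal_kernel:
  fixes B C :: "'a \<Rightarrow> 'a"
  assumes B: "bounded_clinear B" and adj: "\<And>x y. cinner (B x) y = cinner x (C y)"
    and N: "1 \<le> N"
    and band: "\<And>m n. N \<le> m \<Longrightarrow> N \<le> n \<Longrightarrow> m + 2 \<le> n \<or> n + 2 \<le> m \<Longrightarrow> cinner (B (e m)) (e n) = 0"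
    and c: "c > 0" "\<And>n. N \<le> n \<Longrightarrow> c \<le> cmod (cinner (B (e (n + 1))) (e n))"
    and \<delta>: "\<And>n. N \<le> n \<Longrightarrow> cmod (cinner (B (e n)) (e n)) \<le> \<epsilon> * cmod (cinner (B (e (n + 1))) (e n))"
    and \<gamma>: "\<And>n. N \<le> n \<Longrightarrow> cmod (cinner (B (e (n - 1))) (e n)) \<le> q * cmod (cinner (B (e (n + 1))) (e n))"
    and q: "0 \<le> \<epsilon>" "0 \<le> q" "\<epsilon> + q < 1"
  obtains x where "x \<noteq> 0" "B x = 0"
proof -
  have B_add: "B (x + y) = B x + B y" for x y
    using bounded_clinearD(1)[OF B] by (simp add: linear_add bounded_linear.linear)
  have "\<exists>w. (\<forall>i\<le>N. cinner w (e i) = (if i = j then 1 else 0)) \<and> (\<forall>n\<ge>N. cinner (B w) (e n) = 0)"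
    if j: "j \<le> N" for j
  proof -
    \<comment> \<open>For \<open>j < N\<close> the head is \<open>e j\<close>, the tail starts at 0
      and is driven by \<open>B (e j)\<close> through \<open>f\<close>; for \<open>j = N\<close>
      there is no head and the tail starts at 1.\<close>
    define u where "u = (if j < N then e j else 0)"
    define f where "f k = cinner (B u) (e (N + k))" for k
    have f_le: "L2_set (\<lambda>k. cmod (f k)) {..<M} \<le> norm (B u)" for M
    proof -
      have "(\<Sum>k<M. (cmod (f k))\<^sup>2) \<le> (norm (B u))\<^sup>2"
        using onb_bessel[OF onb, of "B u" "N + M"]
          sum_nonneg[of "{..<N}" "\<lambda>n. (cmod (cinner (B u) (e n)))\<^sup>2"]
        by (simp add: f_def sum_lessThan_add)
      then show ?thesis unfolding L2_set_def by (rule real_le_lsqrt[rotated]) simp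
    qed
    let ?\<alpha> = "\<lambda>k. cinner (B (e (N + k + 1))) (e (N + k))"
    let ?\<delta> = "\<lambda>k. cinner (B (e (N + k))) (e (N + k))"
    let ?\<gamma> = "\<lambda>k. cinner (B (e (N + k - 1))) (e (N + k))"
    obtain x K where x0: "x 0 = (if j = N then 1 else 0)"
      and x_rec: "\<And>k. ?\<alpha> k * x (Suc k) + ?\<delta> k * x k + ?\<gamma> k * (if k = 0 then 0 else x (k - 1)) + f k = 0"
      and x_le: "\<And>M. L2_set (\<lambda>k. cmod (x k)) {..<M} \<le> K"
    proof (rule contractive_recurrence_square_summable[where \<alpha> = ?\<alpha> and \<delta> = ?\<delta> and \<gamma> = ?\<gamma> and f = f
          and c = c and \<epsilon> = \<epsilon> and q = q and F = "norm (B u)" and x\<^sub>0 = "if j = N then 1 else 0"])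
      show "c \<le> cmod (?\<alpha> k)" for k by (rule c(2)) simp
      show "cmod (?\<delta> k) \<le> \<epsilon> * cmod (?\<alpha> k)" for k by (rule \<delta>) simp
      show "cmod (?\<gamma> k) \<le> q * cmod (?\<alpha> k)" for k by (rule \<gamma>) simp
    qed (use c(1) q f_le in auto)
    define c' where "c' n = (if n < N then 0 else x (n - N))" for n
    have "(\<Sum>n<M. (cmod (c' n))\<^sup>2) \<le> K\<^sup>2" for M
    proof -
      have "(\<Sum>n<M. (cmod (c' n))\<^sup>2) \<le> (\<Sum>n<N + M. (cmod (c' n))\<^sup>2)"
        by (rule sum_mono2) auto
      also have "\<dots> = (L2_set (\<lambda>k. cmod (x k)) {..<M})\<^sup>2"
        by (simp add: sum_lessThan_add c'_def L2_set_def sum_nonneg)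
      also have "\<dots> \<le> K\<^sup>2"
        by (rule power_mono) (simp_all add: x_le)
      finally show ?thesis .
    qed
    then obtain v where v: "\<And>n. cinner v (e n) = c' n"
      using onb_synthesis[OF onb, of c'] by blast
    have "cinner (B v) (e n) = - cinner (B u) (e n)" if n: "n \<ge> N" for n
    proof -
      obtain k where k: "n = N + k" using n le_Suc_ex by blast
      have ce: "cinner (e m) (C y) = cinner (B (e m)) y" for m y by (simp add: adj)
      have "cinner v (C (e n)) = (\<Sum>m\<in>{n - 1, n, n + 1}. cinner v (e m) * cinner (e m) (C (e n)))"
      proof (rule onb_cinner_finite[OF onb])
        \<comment> \<open>Entries in the rows and columns below \<open>N\<close> are uncontrolled,
          but \<open>v\<close> has no coordinates there.\<close>
        fix m assume "m \<notin> {n - 1, n, n + 1}"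
        then have "m < N \<or> (N \<le> m \<and> (m + 2 \<le> n \<or> n + 2 \<le> m))" by auto
        then show "cinner v (e m) * cinner (e m) (C (e n)) = 0"
          using band[OF _ n] by (auto simp: v c'_def ce)
      qed simp
      also have "\<dots> = c' (n - 1) * ?\<gamma> k + c' n * ?\<delta> k + c' (n + 1) * ?\<alpha> k"
        using N by (cases N) (simp_all add: ce v k algebra_simps)
      \<comment> \<open>In row \<open>N\<close> the index \<open>n - 1\<close> falls into the head,
        where \<open>c'\<close> is 0; this matches the default value of the recurrence at
        \<open>k = 0\<close>.\<close>
      also have "\<dots> = ?\<alpha> k * x (Suc k) + ?\<delta> k * x k + ?\<gamma> k * (if k = 0 then 0 else x (k - 1))"
        using N by (auto simp: c'_def k Suc_diff_le)
      also have "\<dots> = - f k"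
        using x_rec[of k] by (simp add: eq_neg_iff_add_eq_0)
      finally show ?thesis by (simp add: adj[of v] f_def k)
    qed
    moreover have "cinner (u + v) (e i) = (if i = j then 1 else 0)" if "i \<le> N" for i
      using that j by (auto simp: cinner_add_left v c'_def u_def cinner_onb[OF onb] x0)
    ultimately show ?thesis
      by (intro exI[of _ "u + v"]) (simp add: B_add cinner_add_left)
  qed
  then obtain w where w: "\<And>i j. j \<le> N \<Longrightarrow> i \<le> N \<Longrightarrow> cinner (w j) (e i) = (if i = j then 1 else 0)"
    "\<And>j n. j \<le> N \<Longrightarrow> N \<le> n \<Longrightarrow> cinner (B (w j)) (e n) = 0"
    by metis
  obtain g where g: "\<exists>j\<le>N. g j \<noteq> 0" "\<And>i. i < N \<Longrightarrow> (\<Sum>j\<le>N. g j * cinner (B (w j)) (e i)) = 0"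
    using exists_linear_dependence[of N "\<lambda>j i. cinner (B (w j)) (e i)"] by blast
  define x where "x = (\<Sum>j\<le>N. g j *\<^sub>C w j)"
  have "B x = (\<Sum>j\<le>N. g j *\<^sub>C B (w j))"
    unfolding x_def using bounded_clinearD[OF B] by (simp add: linear_sum bounded_linear.linear)
  then have Bx: "cinner (B x) (e n) = (\<Sum>j\<le>N. g j * cinner (B (w j)) (e n))" for n
    by (simp add: cinner_sum_left cinner_scaleC_left)
  have "cinner (B x) (e n) = 0" for n
  proof (cases "n < N")
    case False
    then show ?thesis unfolding Bx by (intro sum.neutral) (simp add: w(2))
  qed (simp add: Bx g(2))
  then have "B x = 0" by (rule onb_eq_0[OF onb])
  moreover have "x \<noteq> 0"
  proof
    assume "x = 0"
    have "g i = 0" if "i \<le> N" for i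
    proof -
      have "cinner x (e i) = (\<Sum>j\<le>N. g j * (if i = j then 1 else 0))"
        unfolding x_def cinner_sum_left cinner_scaleC_left using that by (intro sum.cong) (auto simp: w(1))
      also have "\<dots> = g i" using that by (simp add: if_distrib cong: if_cong)
      finally show ?thesis using \<open>x = 0\<close> by simp
    qed
    then show False using g(1) by blast
  qed
  ultimately show thesis using that by blast
qed

text \<open>The defect consists of the tails of the first \<open>n\<^sub>0\<close> columns, apart from the single entry that sticks
  out of the \<open>n\<close>-th truncation.\<close>

lemma onb_square_norm_partial_sums:
  fixes A :: "'a \<Rightarrow> 'a"
  assumes band: "\<And>i m. n\<^sub>0 \<le> i \<Longrightarrow> i + 2 \<le> m \<Longrightarrow> cinner (A (e i)) (e m) = 0"
  shows "(\<lambda>n. (\<Sum>i\<le>n. (norm (A (e i)))\<^sup>2) - (\<Sum>i\<le>n. \<Sum>m\<le>n. (cmod (cinner (A (e i)) (e m)))\<^sup>2)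
      - (cmod (cinner (A (e n)) (e (Suc n))))\<^sup>2) \<longlonglongrightarrow> 0"
proof -
  let ?s = "\<lambda>i m. (cmod (cinner (A (e i)) (e m)))\<^sup>2"
  let ?h = "\<lambda>n i. (norm (A (e i)))\<^sup>2 - (\<Sum>m\<le>n. ?s i m)"
  have "(\<lambda>n. ?h n i) \<longlonglongrightarrow> 0" for i
  proof -
    have "(\<lambda>n. \<Sum>m\<le>n. ?s i m) \<longlonglongrightarrow> (norm (A (e i)))\<^sup>2"
      using onb_parseval[OF onb, of "A (e i)"] by (simp add: sums_def_le)
    from tendsto_diff[OF tendsto_const[of "(norm (A (e i)))\<^sup>2"] this] show ?thesis
      by simp
  qed
  then have lim: "(\<lambda>n. \<Sum>i<n\<^sub>0. ?h n i) \<longlonglongrightarrow> 0"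
    by (intro tendsto_null_sum)
  have eq: "(\<Sum>i\<le>n. (norm (A (e i)))\<^sup>2) - (\<Sum>i\<le>n. \<Sum>m\<le>n. ?s i m) - ?s n (Suc n) = (\<Sum>i<n\<^sub>0. ?h n i)"
    if n: "n \<ge> n\<^sub>0" for n
  proof -
    have h: "?h n i = (if i = n then ?s n (Suc n) else 0)" if "i \<in> {n\<^sub>0..n}" for i
    proof -
      have i: "n\<^sub>0 \<le> i" "i \<le> n" using that by auto
      have "?s i sums (\<Sum>m\<le>Suc n. ?s i m)"
        by (rule sums_finite) (use i in \<open>auto simp: band\<close>)
      then have "(norm (A (e i)))\<^sup>2 = (\<Sum>m\<le>Suc n. ?s i m)"
        using onb_parseval[OF onb] sums_unique2 by blast
      then show ?thesis using i by (auto simp: band)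
    qed
    have "{..n} = {..<n\<^sub>0} \<union> {n\<^sub>0..n}" using n by auto
    then have "(\<Sum>i\<le>n. ?h n i) = (\<Sum>i<n\<^sub>0. ?h n i) + (\<Sum>i\<in>{n\<^sub>0..n}. ?h n i)"
      by (simp add: sum.union_disjoint Int_commute ivl_disj_int)
    also have "(\<Sum>i\<in>{n\<^sub>0..n}. ?h n i) = (\<Sum>i\<in>{n\<^sub>0..n}. if i = n then ?s n (Suc n) else 0)"
      by (rule sum.cong[OF refl h])
    also have "\<dots> = ?s n (Suc n)" using n by simp
    finally show ?thesis by (simp add: sum_subtractf)
  qed
  show ?thesis
    using eq by (intro Lim_transform_eventually[OF lim] eventually_sequentiallyI[of n\<^sub>0]) simp
qed

end

section \<open>Asymptotics of the tridiagonal coefficients\<close>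

lemma coefficient_asymptotics:
  fixes a b d :: "nat \<Rightarrow> complex"
  assumes K: "\<And>n. cmod (a n) \<le> K" and \<tau>: "\<tau> > 0"
    and lim: "(\<lambda>n. (cmod (a n))\<^sup>2 - (cmod (b n))\<^sup>2) \<longlonglongrightarrow> \<tau>"
    and s1: "summable (\<lambda>n. cmod (a n * cnj (d (Suc n) - d n) - cnj (b n) * (d (Suc n) - d n)))"
    and s2: "summable (\<lambda>n. cmod (a n * cnj (b (Suc n)) - cnj (b n) * a (Suc n)))"
  obtains l c \<epsilon> q where "c > 0" "0 \<le> \<epsilon>" "0 \<le> q" "\<epsilon> + q < 1"
    "eventually (\<lambda>n. c \<le> cmod (a n)) sequentially"
    "eventually (\<lambda>n. cmod (d n - l) \<le> \<epsilon> * cmod (a n)) sequentially"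
    "eventually (\<lambda>n. cmod (b n) \<le> q * cmod (a (Suc n))) sequentially"
proof -
  have "eventually (\<lambda>n. (cmod (a n))\<^sup>2 - (cmod (b n))\<^sup>2 > \<tau> / 2) sequentially"
    using order_tendstoD(1)[OF lim, of "\<tau> / 2"] \<tau> by simp
  then obtain N where N: "\<And>n. n \<ge> N \<Longrightarrow> (cmod (a n))\<^sup>2 - (cmod (b n))\<^sup>2 > \<tau> / 2"
    by (auto simp: eventually_sequentially)
  define c where "c = sqrt (\<tau> / 2)"
  have c: "c > 0" using \<tau> by (simp add: c_def)
  have a_ge: "c \<le> cmod (a n)" if "n \<ge> N" for n
    using N[OF that] \<tau> zero_le_power2[of "cmod (b n)"] unfolding c_def
    by (intro real_le_lsqrt) (simp, linarith)
  have a0: "a n \<noteq> 0" if "n \<ge> N" for n using a_ge[OF that] c by auto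
  have K0: "K > 0" using a_ge[of N] c K[of N] by linarith
  \<comment> \<open>The difference of squares exceeds \<open>\<tau> / 2\<close>, and its factor
    \<open>|a| + |b|\<close> is at most \<open>2 * K\<close>.\<close>
  have gap: "\<tau> / (4 * K) \<le> cmod (a n) - cmod (b n)" if "n \<ge> N" for n
  proof -
    have ba: "cmod (b n) \<le> cmod (a n)"
      using N[OF that] \<tau> by - (rule power2_le_imp_le, linarith, simp)
    have "\<tau> / 2 \<le> (cmod (a n) - cmod (b n)) * (cmod (a n) + cmod (b n))"
      using N[OF that] by (simp add: power2_eq_square algebra_simps)
    also have "\<dots> \<le> (cmod (a n) - cmod (b n)) * (2 * K)"
      using ba K[of n] by (intro mult_left_mono) linarith+
    finally show ?thesis using K0 by (simp add: pos_divide_le_eq)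
  qed
  have "summable (\<lambda>n. d (Suc n) - d n)"
  proof (rule summable_comparison_test')
    show "summable (\<lambda>n. (4 * K / \<tau>) * cmod (a n * cnj (d (Suc n) - d n) - cnj (b n) * (d (Suc n) - d n)))"
      by (intro summable_mult s1)
    fix n assume n: "n \<ge> N"
    let ?\<delta> = "d (Suc n) - d n"
    have "\<tau> / (4 * K) * cmod ?\<delta> \<le> (cmod (a n) - cmod (b n)) * cmod ?\<delta>"
      by (intro mult_right_mono gap n) simp
    also have "\<dots> = cmod (a n * cnj ?\<delta>) - cmod (cnj (b n) * ?\<delta>)"
      unfolding norm_mult complex_mod_cnj left_diff_distrib ..
    also have "\<dots> \<le> cmod (a n * cnj ?\<delta> - cnj (b n) * ?\<delta>)"
      by (rule norm_triangle_ineq2)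
    finally show "norm ?\<delta> \<le> (4 * K / \<tau>) * cmod (a n * cnj ?\<delta> - cnj (b n) * ?\<delta>)"
      using K0 \<tau> by (simp add: field_simps)
  qed
  then have "convergent (\<lambda>n. \<Sum>i<n. d (Suc i) - d i)"
    by (simp add: summable_iff_convergent)
  then obtain l where "(\<lambda>n. d n - d 0) \<longlonglongrightarrow> l"
    by (auto simp: convergent_def sum_lessThan_telescope)
  from tendsto_add[OF this tendsto_const[of "d 0"]] have d_lim: "d \<longlonglongrightarrow> l + d 0"
    by simp
  \<comment> \<open>The second off-diagonal expression is exactly \<open>a n * a (Suc n)\<close>
    times the increment of \<open>\<beta>\<close>, and the product has modulus at least
    \<open>c\<^sup>2\<close>.\<close>
  define \<beta> where "\<beta> n = cnj (b n) / a n" for n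
  have "summable (\<lambda>n. \<beta> (Suc n) - \<beta> n)"
  proof (rule summable_comparison_test')
    show "summable (\<lambda>n. (1 / c\<^sup>2) * cmod (a n * cnj (b (Suc n)) - cnj (b n) * a (Suc n)))"
      by (intro summable_mult s2)
    fix n assume n: "n \<ge> N"
    have "\<beta> (Suc n) - \<beta> n = (a n * cnj (b (Suc n)) - cnj (b n) * a (Suc n)) / (a n * a (Suc n))"
      using a0[of n] a0[of "Suc n"] n by (simp add: \<beta>_def field_simps)
    then have "norm (\<beta> (Suc n) - \<beta> n)
        = cmod (a n * cnj (b (Suc n)) - cnj (b n) * a (Suc n)) / (cmod (a n) * cmod (a (Suc n)))"
      by (simp add: norm_divide norm_mult)
    also have "\<dots> \<le> cmod (a n * cnj (b (Suc n)) - cnj (b n) * a (Suc n)) / c\<^sup>2"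
      using a_ge[of n] a_ge[of "Suc n"] n c unfolding power2_eq_square
      by (intro divide_left_mono mult_mono mult_pos_pos) auto
    finally show "norm (\<beta> (Suc n) - \<beta> n)
        \<le> (1 / c\<^sup>2) * cmod (a n * cnj (b (Suc n)) - cnj (b n) * a (Suc n))"
      by simp
  qed
  then have "convergent (\<lambda>n. \<Sum>i<n. \<beta> (Suc i) - \<beta> i)"
    by (simp add: summable_iff_convergent)
  then obtain \<beta>' where "(\<lambda>n. \<beta> n - \<beta> 0) \<longlonglongrightarrow> \<beta>'"
    by (auto simp: convergent_def sum_lessThan_telescope)
  from tendsto_norm[OF tendsto_add[OF this tendsto_const[of "\<beta> 0"]]]
  obtain r where r: "(\<lambda>n. cmod (\<beta> n)) \<longlonglongrightarrow> r" by auto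
  have ab: "(cmod (a n))\<^sup>2 - (cmod (b n))\<^sup>2 = (cmod (a n))\<^sup>2 * (1 - (cmod (\<beta> n))\<^sup>2)" if "n \<ge> N" for n
    using a0[OF that] by (simp add: \<beta>_def norm_divide power_divide field_simps)
  \<comment> \<open>Having each modulus of \<open>\<beta> n\<close> below 1 would only give
    \<open>r \<le> 1\<close> in the limit; the bound \<open>K\<close> on \<open>a\<close> keeps the
    distance uniform.\<close>
  have "\<tau> / (2 * K\<^sup>2) \<le> 1 - (cmod (\<beta> n))\<^sup>2" if n: "n \<ge> N" for n
  proof -
    have less: "\<tau> / 2 < (cmod (a n))\<^sup>2 * (1 - (cmod (\<beta> n))\<^sup>2)"
      using N[OF n] by (simp only: ab[OF n])
    then have "0 < (cmod (a n))\<^sup>2 * (1 - (cmod (\<beta> n))\<^sup>2)" using \<tau> by linarith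
    then have "0 < 1 - (cmod (\<beta> n))\<^sup>2"
      by (rule zero_less_mult_pos) (simp add: a0[OF n])
    then have "(cmod (a n))\<^sup>2 * (1 - (cmod (\<beta> n))\<^sup>2) \<le> K\<^sup>2 * (1 - (cmod (\<beta> n))\<^sup>2)"
      using K by (intro mult_right_mono power_mono) auto
    with less have "\<tau> / 2 \<le> K\<^sup>2 * (1 - (cmod (\<beta> n))\<^sup>2)" by linarith
    then show ?thesis using K0 by (simp add: pos_divide_le_eq mult_ac)
  qed
  moreover have r2: "(\<lambda>n. 1 - (cmod (\<beta> n))\<^sup>2) \<longlonglongrightarrow> 1 - r\<^sup>2"
    by (intro tendsto_intros r)
  ultimately have "\<tau> / (2 * K\<^sup>2) \<le> 1 - r\<^sup>2"
    by (intro Lim_bounded2[OF r2, of N]) auto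
  moreover have "\<tau> / (2 * K\<^sup>2) > 0" using \<tau> K0 by simp
  ultimately have r2_pos: "1 - r\<^sup>2 > 0" by linarith
  have r0: "0 \<le> r" by (rule Lim_bounded2[OF r, of 0]) simp
  have r1: "r < 1" using r2_pos by (simp add: abs_square_less_1)
  have "(\<lambda>n. ((cmod (a n))\<^sup>2 - (cmod (b n))\<^sup>2) / (1 - (cmod (\<beta> n))\<^sup>2)) \<longlonglongrightarrow> \<tau> / (1 - r\<^sup>2)"
    using r2_pos by (intro tendsto_divide lim r2) simp
  then have "(\<lambda>n. (cmod (a n))\<^sup>2) \<longlonglongrightarrow> \<tau> / (1 - r\<^sup>2)"
  proof (rule Lim_transform_eventually)
    have "eventually (\<lambda>n. 1 - (cmod (\<beta> n))\<^sup>2 > 0) sequentially"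
      using order_tendstoD(1)[OF r2 r2_pos] .
    then show "\<forall>\<^sub>F n in sequentially. ((cmod (a n))\<^sup>2 - (cmod (b n))\<^sup>2) / (1 - (cmod (\<beta> n))\<^sup>2) = (cmod (a n))\<^sup>2"
      using eventually_ge_at_top[of N] by eventually_elim (simp add: ab)
  qed
  from tendsto_real_sqrt[OF this] obtain A where A: "(\<lambda>n. cmod (a n)) \<longlonglongrightarrow> A" "A > 0"
    using \<tau> r2_pos by auto
  \<comment> \<open>Convergence of the moduli of \<open>a\<close> to a positive limit allows the
    denominator of the ratio to be shifted by one index.\<close>
  have "(\<lambda>n. cmod (\<beta> n) * cmod (a n) / cmod (a (Suc n))) \<longlonglongrightarrow> r * A / A"
    using A by (intro tendsto_intros r LIMSEQ_Suc[of "\<lambda>n. cmod (a n)"]) auto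
  then have ratio: "(\<lambda>n. cmod (\<beta> n) * cmod (a n) / cmod (a (Suc n))) \<longlonglongrightarrow> r"
    using A(2) by simp
  \<comment> \<open>\<open>q\<close> is the midpoint between \<open>r\<close> and 1, and
    \<open>\<epsilon>\<close> takes half of what then remains below 1.\<close>
  define q where "q = (1 + r) / 2"
  define \<epsilon> where "\<epsilon> = (1 - q) / 2"
  have q: "r < q" "q < 1" "\<epsilon> > 0" "\<epsilon> + q < 1" using r1 by (simp_all add: q_def \<epsilon>_def field_simps)
  have "eventually (\<lambda>n. cmod (b n) \<le> q * cmod (a (Suc n))) sequentially"
    using order_tendstoD(2)[OF ratio q(1)] eventually_ge_at_top[of N]
  proof eventually_elim
    case (elim n)
    then show ?case
      using a0[of n] a0[of "Suc n"] by (simp add: \<beta>_def norm_divide field_simps)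
  qed
  moreover have "eventually (\<lambda>n. cmod (d n - (l + d 0)) \<le> \<epsilon> * cmod (a n)) sequentially"
    using tendstoD[OF d_lim mult_pos_pos[OF q(3) c]] eventually_ge_at_top[of N]
  proof eventually_elim
    case (elim n)
    then show ?case
      using mult_left_mono[OF a_ge[OF elim(2)] less_imp_le[OF q(3)]] unfolding dist_norm by linarith
  qed
  moreover have "eventually (\<lambda>n. c \<le> cmod (a n)) sequentially"
    using eventually_ge_at_top[of N] a_ge by (rule eventually_mono)
  ultimately show thesis
    using that[of c \<epsilon> q] c q r0 by simp
qed

section \<open>Eigenvectors and hyperinvariant subspaces\<close>

lemma abs_summable_product_shift:
  fixes u v :: "nat \<Rightarrow> complex"
  assumes "summable (\<lambda>n. (cmod (u n))\<^sup>2)" "summable (\<lambda>n. (cmod (v n))\<^sup>2)"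
  shows "summable (\<lambda>n. cmod (u n * v (n + k)))"
proof (rule summable_comparison_test')
  show "summable (\<lambda>n. (cmod (u n))\<^sup>2 + (cmod (v (n + k)))\<^sup>2)"
    by (intro summable_add assms(1) summable_ignore_initial_segment[OF assms(2)])
  show "norm (cmod (u n * v (n + k))) \<le> (cmod (u n))\<^sup>2 + (cmod (v (n + k)))\<^sup>2" for n
    using sum_squares_bound[of "cmod (u n)" "cmod (v (n + k))"]
      mult_nonneg_nonneg[OF norm_ge_zero[of "u n"] norm_ge_zero[of "v (n + k)"]]
    unfolding real_norm_def abs_norm_cancel norm_mult by linarith
qed

text \<open>The operators are kept as an adjoint pair, so that a negative trace can be treated by
  exchanging them. A positive trace makes the entries \<open>a\<close> dominate, and solving the
  eigenvector equation of \<open>S\<close> for its newest coordinate divides by precisely these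
  entries, conjugated.\<close>

lemma eigenvector_if_positive_trace:
  fixes e :: "nat \<Rightarrow> 'a::complex_hilbert" and T S :: "'a \<Rightarrow> 'a"
  defines "C \<equiv> \<lambda>x. S (T x) - T (S x)"
  assumes onb: "is_onb_seq e"
    and T: "bounded_clinear T" and S: "bounded_clinear S"
    and adj: "\<And>x y. cinner (T x) y = cinner x (S y)"
    and band: "\<And>i m. n\<^sub>0 \<le> i \<Longrightarrow> i + 2 \<le> m \<Longrightarrow> cinner (T (e i)) (e m) = 0"
      "\<And>i m. n\<^sub>0 \<le> i \<Longrightarrow> i + 2 \<le> m \<Longrightarrow> cinner (S (e i)) (e m) = 0"
    and summ: "\<And>k. summable (\<lambda>n. cmod (cinner (C (e n)) (e (n + k))))"
    and trace: "(\<lambda>n. cinner (C (e n)) (e n)) sums t" and t: "Re t > 0"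
  obtains \<mu> x where "x \<noteq> 0" "S x = \<mu> *\<^sub>C x"
proof -
  \<comment> \<open>The first index belongs to the argument, so \<open>s\<close> is the transpose of
    the usual matrix and \<open>a\<close> is its subdiagonal in the usual sense.\<close>
  define s where "s i m = cinner (T (e i)) (e m)" for i m
  define a where "a n = s n (Suc n)" for n
  define b where "b n = s (Suc n) n" for n
  define d where "d n = s n n" for n
  have adj': "cinner (S x) y = cinner x (T y)" for x y
    by (metis adj cinner_commute)
  have S_entry: "cinner (S (e i)) (e m) = cnj (s m i)" for i m
    unfolding s_def adj' by (rule cinner_commute)
  have s_band: "s i m = 0" if "n\<^sub>0 \<le> i" "n\<^sub>0 \<le> m" "i + 2 \<le> m \<or> m + 2 \<le> i" for i m
    using that band(1)[of i m] band(2)[of m i] S_entry[of m i] by (auto simp: s_def)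
  have C_entry: "cinner (C (e n)) (e m) = cinner (T (e n)) (T (e m)) - cinner (S (e n)) (S (e m))" for n m
    by (simp add: C_def cinner_diff_left adj adj')
  have C_expand: "cinner (C (e n)) (e m) =
      (\<Sum>j\<in>A. s n j * cnj (s m j)) - (\<Sum>j\<in>A. cnj (s j n) * s j m)"
    if A: "finite A" "\<And>j. j \<notin> A \<Longrightarrow> s n j * cnj (s m j) = 0" "\<And>j. j \<notin> A \<Longrightarrow> cnj (s j n) * s j m = 0"
    for n m A
  proof -
    have T_e: "cinner (e j) (T (e m)) = cnj (s m j)" for j
      unfolding s_def by (rule cinner_commute)
    have S_e: "cinner (e j) (S (e m)) = s j m" for j
      unfolding s_def by (rule adj[symmetric])
    have "cinner (T (e n)) (T (e m)) = (\<Sum>j\<in>A. s n j * cnj (s m j))"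
      using A by (subst onb_cinner_finite[OF onb A(1)]) (simp_all add: T_e flip: s_def)
    moreover have "cinner (S (e n)) (S (e m)) = (\<Sum>j\<in>A. cnj (s j n) * s j m)"
      using A by (subst onb_cinner_finite[OF onb A(1)]) (simp_all add: S_e S_entry)
    ultimately show ?thesis by (simp add: C_entry)
  qed
  \<comment> \<open>\<open>X\<close> collects the intermediate indices below
    \<open>n\<^sub>0\<close>, where the band structure fails. Rows and columns are square summable,
    so these finitely many products are absolutely summable along each diagonal.\<close>
  define X where "X k n = (\<Sum>j<n\<^sub>0. s n j * cnj (s (n + k) j)) - (\<Sum>j<n\<^sub>0. cnj (s j n) * s j (n + k))" for k n
  have X_summable: "summable (\<lambda>n. cmod (X k n))" for k
  proof (rule summable_comparison_test')
    have row: "summable (\<lambda>n. (cmod (s j n))\<^sup>2)" for j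
      unfolding s_def by (rule sums_summable[OF onb_parseval[OF onb]])
    have "summable (\<lambda>n. (cmod (cinner (S (e j)) (e n)))\<^sup>2)" for j
      by (rule sums_summable[OF onb_parseval[OF onb]])
    then have column: "summable (\<lambda>n. (cmod (s n j))\<^sup>2)" for j
      by (simp add: S_entry)
    have "summable (\<lambda>n. cmod (s n j * cnj (s (n + k) j)))" for j
      by (rule abs_summable_product_shift[of "\<lambda>n. s n j" "\<lambda>n. cnj (s n j)"]) (simp_all add: column)
    moreover have "summable (\<lambda>n. cmod (cnj (s j n) * s j (n + k)))" for j
      by (rule abs_summable_product_shift[of "\<lambda>n. cnj (s j n)" "\<lambda>n. s j n"]) (simp_all add: row)
    ultimately show "summable (\<lambda>n. (\<Sum>j<n\<^sub>0. cmod (s n j * cnj (s (n + k) j)))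
        + (\<Sum>j<n\<^sub>0. cmod (cnj (s j n) * s j (n + k))))"
      by (intro summable_add summable_sum)
    show "norm (cmod (X k n)) \<le> (\<Sum>j<n\<^sub>0. cmod (s n j * cnj (s (n + k) j)))
        + (\<Sum>j<n\<^sub>0. cmod (cnj (s j n) * s j (n + k)))" for n
      unfolding X_def real_norm_def abs_norm_cancel
      by (intro order_trans[OF norm_triangle_ineq4] add_mono norm_sum)
  qed
  have summable_diagonal: "summable (\<lambda>n. cmod (f n))"
    if "\<And>n. n > n\<^sub>0 \<Longrightarrow> f n = cinner (C (e n)) (e (n + k)) - X k n" for f k
  proof (rule summable_comparison_test')
    show "summable (\<lambda>n. cmod (cinner (C (e n)) (e (n + k))) + cmod (X k n))"
      by (intro summable_add summ X_summable)
    show "norm (cmod (f n)) \<le> cmod (cinner (C (e n)) (e (n + k))) + cmod (X k n)" if "n \<ge> Suc n\<^sub>0" for n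
      using that \<open>\<And>n. n > n\<^sub>0 \<Longrightarrow> f n = _ n\<close> by (simp add: norm_triangle_ineq4)
  qed
  have s1: "summable (\<lambda>n. cmod (a n * cnj (d (Suc n) - d n) - cnj (b n) * (d (Suc n) - d n)))"
  proof (rule summable_diagonal[of _ 1])
    fix n assume n: "n > n\<^sub>0"
    \<comment> \<open>From \<open>n\<^sub>0\<close> on, only \<open>n\<close> and
      \<open>n + 1\<close> lie within distance one of both of them. For the second off-diagonal, the
      sole common neighbour of \<open>n\<close> and \<open>n + 2\<close> is
      \<open>n + 1\<close>.\<close>
    have "cinner (C (e n)) (e (n + 1)) = (\<Sum>j\<in>{..<n\<^sub>0} \<union> {n, Suc n}. s n j * cnj (s (n + 1) j))
        - (\<Sum>j\<in>{..<n\<^sub>0} \<union> {n, Suc n}. cnj (s j n) * s j (n + 1))"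
    proof (rule C_expand)
      fix j assume "j \<notin> {..<n\<^sub>0} \<union> {n, Suc n}"
      then have "n\<^sub>0 \<le> j" "j + 2 \<le> n + 1 \<or> n + 2 \<le> j" by auto
      then show "s n j * cnj (s (n + 1) j) = 0" "cnj (s j n) * s j (n + 1) = 0"
        using n s_band[of n j] s_band[of "n + 1" j] s_band[of j n] s_band[of j "n + 1"] by auto
    qed simp
    then show "a n * cnj (d (Suc n) - d n) - cnj (b n) * (d (Suc n) - d n)
        = cinner (C (e n)) (e (n + 1)) - X 1 n"
      using n by (simp add: sum.union_disjoint X_def a_def b_def d_def algebra_simps)
  qed
  have s2: "summable (\<lambda>n. cmod (a n * cnj (b (Suc n)) - cnj (b n) * a (Suc n)))"
  proof (rule summable_diagonal[of _ 2])
    fix n assume n: "n > n\<^sub>0"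
    have "cinner (C (e n)) (e (n + 2)) = (\<Sum>j\<in>{..<n\<^sub>0} \<union> {Suc n}. s n j * cnj (s (n + 2) j))
        - (\<Sum>j\<in>{..<n\<^sub>0} \<union> {Suc n}. cnj (s j n) * s j (n + 2))"
    proof (rule C_expand)
      fix j assume "j \<notin> {..<n\<^sub>0} \<union> {Suc n}"
      then have "n\<^sub>0 \<le> j" "j + 2 \<le> n + 2 \<or> n + 2 \<le> j" by auto
      then show "s n j * cnj (s (n + 2) j) = 0" "cnj (s j n) * s j (n + 2) = 0"
        using n s_band[of n j] s_band[of "n + 2" j] s_band[of j n] s_band[of j "n + 2"] by auto
    qed simp
    then show "a n * cnj (b (Suc n)) - cnj (b n) * a (Suc n) = cinner (C (e n)) (e (n + 2)) - X 2 n"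
      using n by (simp add: sum.union_disjoint X_def a_def b_def)
  qed
  have lim: "(\<lambda>n. (cmod (a n))\<^sup>2 - (cmod (b n))\<^sup>2) \<longlonglongrightarrow> Re t"
  proof -
    have C_diag: "Re (cinner (C (e i)) (e i)) = (norm (T (e i)))\<^sup>2 - (norm (S (e i)))\<^sup>2" for i
      by (simp add: C_entry cinner_self)
    have "(\<lambda>i. Re (cinner (C (e i)) (e i))) sums Re t"
      by (rule bounded_linear.sums[OF bounded_linear_Re trace])
    then have 1: "(\<lambda>n. (\<Sum>i\<le>n. (norm (T (e i)))\<^sup>2) - (\<Sum>i\<le>n. (norm (S (e i)))\<^sup>2)) \<longlonglongrightarrow> Re t"
      by (simp add: sums_def_le C_diag sum_subtractf)
    have 2: "(\<lambda>n. (\<Sum>i\<le>n. (norm (T (e i)))\<^sup>2) - (\<Sum>i\<le>n. \<Sum>m\<le>n. (cmod (s i m))\<^sup>2) - (cmod (a n))\<^sup>2) \<longlonglongrightarrow> 0"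
      using onb_square_norm_partial_sums[OF onb, of n\<^sub>0 T] band(1) by (simp add: s_def a_def)
    have 3: "(\<lambda>n. (\<Sum>i\<le>n. (norm (S (e i)))\<^sup>2) - (\<Sum>i\<le>n. \<Sum>m\<le>n. (cmod (s m i))\<^sup>2) - (cmod (b n))\<^sup>2) \<longlonglongrightarrow> 0"
      using onb_square_norm_partial_sums[OF onb, of n\<^sub>0 S] band(2) by (simp add: S_entry b_def)
    \<comment> \<open>The square truncations of \<open>T\<close> and its adjoint have the same sum
      of squared entries. They cancel, leaving the two entries that stick out, \<open>a n\<close>
      and \<open>b n\<close>.\<close>
    have swap: "(\<Sum>i\<le>n. \<Sum>m\<le>n. (cmod (s m i))\<^sup>2) = (\<Sum>i\<le>n. \<Sum>m\<le>n. (cmod (s i m))\<^sup>2)" for n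
      by (rule sum.swap)
    show ?thesis
      using tendsto_diff[OF 1 tendsto_diff[OF 2 3]] by (simp add: swap)
  qed
  obtain K where K: "\<And>x. norm (T x) \<le> norm x * K"
    using bounded_linear.bounded[OF bounded_clinearD(1)[OF T]] by blast
  have norm_e: "norm (e n) = 1" for n
    using onb by (simp add: is_onb_seq_def is_onb_def)
  have a_le: "cmod (a n) \<le> K" for n
    using norm_cinner_le[of "T (e n)" "e (Suc n)"] K[of "e n"] by (simp add: a_def s_def norm_e)
  obtain l c \<epsilon> q where c: "c > 0" and q: "0 \<le> \<epsilon>" "0 \<le> q" "\<epsilon> + q < 1"
    and ev: "eventually (\<lambda>n. c \<le> cmod (a n)) sequentially"
    "eventually (\<lambda>n. cmod (d n - l) \<le> \<epsilon> * cmod (a n)) sequentially"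
    "eventually (\<lambda>n. cmod (b n) \<le> q * cmod (a (Suc n))) sequentially"
    by (rule coefficient_asymptotics[OF a_le t lim s1 s2])
  obtain M where M: "\<And>n. n \<ge> M \<Longrightarrow> c \<le> cmod (a n) \<and> cmod (d n - l) \<le> \<epsilon> * cmod (a n) \<and>
      cmod (b n) \<le> q * cmod (a (Suc n))"
    using eventually_conj[OF ev(1) eventually_conj[OF ev(2,3)]] unfolding eventually_sequentially by blast
  \<comment> \<open>The successor is taken because row \<open>n\<close> of \<open>B\<close> involves
    \<open>b (n - 1)\<close>; the estimate is applied at \<open>n - 1\<close>, where it compares
    \<open>b (n - 1)\<close> with \<open>a n\<close>.\<close>
  define N where "N = Suc (max M n\<^sub>0)"
  have N: "M < N" "n\<^sub>0 < N" by (simp_all add: N_def)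
  define B where "B x = S x - cnj l *\<^sub>C x" for x
  have B: "bounded_clinear B"
    unfolding B_def
    by (intro bounded_clinear_diff S)
      (simp add: bounded_clinear_def bounded_linear_scaleC scaleC_scaleC mult.commute)
  have B_entry: "cinner (B (e m)) (e n) = cnj (s n m - (if m = n then l else 0))" for m n
    by (simp add: B_def cinner_diff_left cinner_scaleC_left S_entry cinner_onb[OF onb])
  have sup: "cmod (cinner (B (e (n + 1))) (e n)) = cmod (a n)" for n
    unfolding B_entry complex_mod_cnj by (simp add: a_def)
  obtain x where x: "x \<noteq> 0" "B x = 0"
  proof (rule eventually_tridiagonal_kernel[OF onb B])
    show "cinner (B x) y = cinner x (T y - l *\<^sub>C y)" for x y
      by (simp add: B_def cinner_diff_left cinner_diff_right cinner_scaleC_left cinner_scaleC_right adj')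
    show "1 \<le> N" by (simp add: N_def)
    show "cinner (B (e m)) (e n) = 0" if "N \<le> m" "N \<le> n" "m + 2 \<le> n \<or> n + 2 \<le> m" for m n
      using that N s_band[of n m] by (auto simp: B_entry)
    show "c \<le> cmod (cinner (B (e (n + 1))) (e n))" if "N \<le> n" for n
      unfolding sup using M[of n] that N by simp
    show "cmod (cinner (B (e n)) (e n)) \<le> \<epsilon> * cmod (cinner (B (e (n + 1))) (e n))" if "N \<le> n" for n
      unfolding sup unfolding B_entry complex_mod_cnj using M[of n] that N by (simp add: d_def)
    show "cmod (cinner (B (e (n - 1))) (e n)) \<le> q * cmod (cinner (B (e (n + 1))) (e n))" if n: "N \<le> n" for n
    proof -
      obtain k where "n = Suc k" "M \<le> k" using n N by (cases n) auto
      then show ?thesis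
        unfolding sup unfolding B_entry complex_mod_cnj using M[of k] by (simp add: b_def)
    qed
  qed (use c q in auto)
  then have "S x = cnj l *\<^sub>C x" by (simp add: B_def)
  then show thesis using x(1) that by blast
qed

section \<open>Hyperinvariant subspaces from eigenvectors\<close>

lemma eigenspace_hyperinvariant:
  fixes T :: "'a::complex_hilbert \<Rightarrow> 'a"
  assumes T: "bounded_clinear T"
  shows "hyperinvariant T {x. T x = \<mu> *\<^sub>C x}"
  unfolding hyperinvariant_def closed_csubspace_def
proof (intro conjI allI impI)
  have bl: "bounded_linear T" by (rule bounded_clinearD(1)[OF T])
  show "csubspace {x. T x = \<mu> *\<^sub>C x}"
    using bl bounded_clinearD(2)[OF T]
    by (auto simp: complex_vector.subspace_def linear_simps scaleC_add_right scaleC_scaleC mult.commute)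
  show "closed {x. T x = \<mu> *\<^sub>C x}"
    by (intro closed_Collect_eq linear_continuous_on bl bounded_linear_scaleC)
  fix S :: "'a \<Rightarrow> 'a" assume S: "bounded_clinear S \<and> S \<circ> T = T \<circ> S"
  then have "T (S x) = S (T x)" "S (\<mu> *\<^sub>C x) = \<mu> *\<^sub>C S x" for x
    by (auto simp: fun_eq_iff bounded_clinearD(2))
  then show "S ` {x. T x = \<mu> *\<^sub>C x} \<subseteq> {x. T x = \<mu> *\<^sub>C x}" by auto
qed

text \<open>If \<open>U\<close> commutes with \<open>T\<close>, its adjoint commutes with
  \<open>S\<close> and so preserves the eigenspace of \<open>S\<close>; therefore \<open>U\<close>
  preserves the orthogonal complement.\<close>

lemma adjoint_eigenspace_complement_hyperinvariant:
  fixes T S :: "'a::complex_hilbert \<Rightarrow> 'a"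
  assumes onb: "is_onb_seq (e :: nat \<Rightarrow> 'a)" and adj: "\<And>x y. cinner (T x) y = cinner x (S y)"
  shows "hyperinvariant T {x. \<forall>y. S y = \<mu> *\<^sub>C y \<longrightarrow> cinner x y = 0}"
  unfolding hyperinvariant_def closed_csubspace_def
proof (intro conjI allI impI)
  let ?M = "{x. \<forall>y. S y = \<mu> *\<^sub>C y \<longrightarrow> cinner x y = 0}"
  show "csubspace ?M"
    by (auto simp: complex_vector.subspace_def cinner_add_left cinner_scaleC_left)
  have "?M = (\<Inter>y\<in>{y. S y = \<mu> *\<^sub>C y}. {x. cinner x y = 0})" by auto
  also have "closed \<dots>"
    by (intro closed_INT ballI closed_Collect_eq linear_continuous_on bounded_linear_cinner_left continuous_on_const)
  finally show "closed ?M" .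
  fix U :: "'a \<Rightarrow> 'a" assume U: "bounded_clinear U \<and> U \<circ> T = T \<circ> U"
  then have comm: "T (U x) = U (T x)" for x by (auto simp: fun_eq_iff)
  obtain V where V: "bounded_clinear V" "\<And>x y. cinner (U x) y = cinner x (V y)"
    using adjoint_exists[OF onb] U by blast
  have VS: "S (V y) = V (S y)" for y
  proof -
    have "cinner (S (V y) - V (S y)) (S (V y) - V (S y)) = 0"
      by (simp add: cinner_diff_right comm flip: adj V(2))
    then show ?thesis by (simp add: cinner_self)
  qed
  show "U ` ?M \<subseteq> ?M"
    by (auto simp: V(2) VS bounded_clinearD(2)[OF V(1)])
qed

theorem corollary2p5:
  fixes T :: "'a::complex_hilbert \<Rightarrow> 'a"
  assumes "\<not> finite_cdim TYPE('a)"
    and "separable_space (euclidean :: 'a topology)"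
    and "bounded_clinear T"
    and "\<not> (\<exists>c. \<forall>x. T x = c *\<^sub>C x)"
    and "\<exists>(e :: nat \<Rightarrow> 'a) n0. is_onb_seq e \<and>
      (\<forall>l\<ge>2. \<forall>n\<ge>n0. cinner (T (e n)) (e (n + l)) = 0 \<and>
                     cinner (cadjoint T (e n)) (e (n + l)) = 0)"
    and "trace_class (self_commutator T)"
    and "op_trace (self_commutator T) \<noteq> 0"
  shows "\<exists>M. hyperinvariant T M \<and> nontrivial_subspace M"
proof -
  note T = assms(3) and nonscalar = assms(4) and tc = assms(6)
  obtain e :: "nat \<Rightarrow> 'a" and n0 where onb: "is_onb_seq e"
    and e: "\<And>l n. 2 \<le> l \<Longrightarrow> n0 \<le> n \<Longrightarrow> cinner (T (e n)) (e (n + l)) = 0 \<and>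
                     cinner (cadjoint T (e n)) (e (n + l)) = 0"
    using assms(5) by blast
  obtain S where S: "bounded_clinear S" and adj: "\<And>x y. cinner (T x) y = cinner x (S y)"
    using adjoint_exists[OF onb T] by blast
  have cadj: "cadjoint T = S" using adj by (rule cadjoint_eq)
  have adj': "cinner (S x) y = cinner x (T y)" for x y
    by (metis adj cinner_commute)
  have band: "cinner (T (e i)) (e m) = 0" "cinner (S (e i)) (e m) = 0" if "n0 \<le> i" "i + 2 \<le> m" for i m
    using e[of "m - i" i] that by (simp_all add: cadj)
  define C where "C = self_commutator T"
  have C_apply: "C x = S (T x) - T (S x)" for x
    by (simp add: C_def self_commutator_def cadj)
  have C_sa: "cinner (C x) y = cinner x (C y)" for x y
    by (simp add: C_apply cinner_diff_left cinner_diff_right adj adj')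
  have C_tc: "trace_class C" using tc by (simp add: C_def)
  let ?t = "op_trace C"
  have trace: "(\<lambda>n. cinner (C (e n)) (e n)) sums ?t"
    using C_tc C_sa onb by (rule op_trace_sums)
  have summ: "summable (\<lambda>n. cmod (cinner (C (e n)) (e (n + k))))" for k
    using C_tc C_sa onb by (rule abs_summable_matrix_diagonal)
  \<comment> \<open>Self-adjointness makes the trace real, so being nonzero gives it a sign.\<close>
  have "Im (cinner (C (e n)) (e n)) = 0" for n
    using C_sa[of "e n" "e n"] cinner_commute[of "C (e n)" "e n"] by (simp add: complex_eq_iff)
  then have "Im ?t = 0"
    using bounded_linear.sums[OF bounded_linear_Im trace] by (simp add: sums_iff)
  then have "Re ?t \<noteq> 0" using assms(7) by (auto simp: C_def complex_eq_iff)
  then consider "Re ?t > 0" | "Re ?t < 0" by linarith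
  then show ?thesis
  proof cases
    case 1
    obtain \<mu> y where y: "y \<noteq> 0" "S y = \<mu> *\<^sub>C y"
      by (rule eigenvector_if_positive_trace[OF onb T S adj band _ _ 1])
        (use summ trace in \<open>simp_all add: C_apply\<close>)
    let ?M = "{x. \<forall>y. S y = \<mu> *\<^sub>C y \<longrightarrow> cinner x y = 0}"
    \<comment> \<open>The range of \<open>T - cnj \<mu>\<close> is orthogonal to the eigenspace and
      is nonzero because \<open>T\<close> is not scalar; this keeps the complement from being
      \<open>{0}\<close>.\<close>
    obtain z where z: "T z - cnj \<mu> *\<^sub>C z \<noteq> 0" using nonscalar by auto
    have "T z - cnj \<mu> *\<^sub>C z \<in> ?M"
      by (simp add: cinner_diff_left adj cinner_scaleC_left cinner_scaleC_right)
    then have "?M \<noteq> {0}" using z by (metis singletonD)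
    moreover have "y \<notin> ?M" using y by (auto simp: cinner_self)
    then have "?M \<noteq> UNIV" by (metis UNIV_I)
    ultimately have "nontrivial_subspace ?M"
      unfolding nontrivial_subspace_def by (rule conjI)
    then show ?thesis
      using adjoint_eigenspace_complement_hyperinvariant[OF onb adj] by blast
  next
    case 2
    \<comment> \<open>Exchanging \<open>T\<close> and \<open>S\<close> changes the sign of the
      commutator, so here \<open>T\<close> itself has an eigenvector. Its eigenspace is proper
      because \<open>T\<close> is not scalar.\<close>
    have neg: "T (S x) - S (T x) = - C x" for x by (simp add: C_apply)
    obtain \<mu> x where x: "x \<noteq> 0" "T x = \<mu> *\<^sub>C x"
    proof (rule eigenvector_if_positive_trace[OF onb S T adj' band(2,1)])
      show "(\<lambda>n. cinner (T (S (e n)) - S (T (e n))) (e n)) sums (- ?t)"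
        unfolding neg cinner_minus_left by (rule sums_minus[OF trace])
      show "summable (\<lambda>n. cmod (cinner (T (S (e n)) - S (T (e n))) (e (n + k))))" for k
        unfolding neg cinner_minus_left norm_minus_cancel by (rule summ)
    qed (use 2 in auto)
    have "nontrivial_subspace {x. T x = \<mu> *\<^sub>C x}"
      using x nonscalar by (auto simp: nontrivial_subspace_def)
    then show ?thesis using eigenspace_hyperinvariant[OF T] by blast
  qed
qed

end
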